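(* For any two partitions $\mu^1,\mu^2$, the following identities of formal power series in $Q$ hold: $$K_{\mu^1\mu^2}(Q)=K_{(0)(0)}(Q)\,\mathcal{W}_{\mu^1}\mathcal{W}_{\mu^2}\exp\left(\sum_{n=1}^{\infty}\frac{Q^n}{n}f_{\mu^1\mu^2}(q^n)\right)=K_{(0)(0)}(Q)\,\mathcal{W}_{\mu^1}\mathcal{W}_{\mu^2}\prod_k(1-q^kQ)^{-C_k(\mu^1,\mu^2)}.$$
   Context: A partition $\mu$ is a nonincreasing sequence $\mu_1\ge\mu_2\ge\cdots$ of nonnegative integers with finitely many nonzero terms; $l(\mu)$ is the number of nonzero terms, $|\mu|=\sum_i\mu_i$, and $(0)$ is the empty partition. Put $\kappa_\mu=\sum_{i=1}^{l(\mu)}\mu_i(\mu_i-2i+1)$ (so $\kappa_{(0)}=0$). Let $q$ be an indeterminate and $[m]=q^{m/2}-q^{-m/2}$. For a symmetric function $F$, $F(q^{\mu+\rho})$ denotes its evaluation at $x_i=q^{\mu_i-i+1/2}$, $i\ge1$, regarded as a rational function of $q^{1/2}$ (the series converge for $|q|>1$; the power sums become $p_n=\sum_{i=1}^{l(\mu)}(q^{n(\mu_i-i+1/2)}-q^{n(-i+1/2)})+\frac{1}{q^{n/2}-q^{-n/2}}$). $s_\nu$ is the Schur function. Define $$\mathcal{W}_\mu=q^{\kappa_\mu/4}\prod_{1\le i<j\le l(\mu)}\frac{[\mu_i-\mu_j+j-i]}{[j-i]}\prod_{i=1}^{l(\mu)}\prod_{v=1}^{\mu_i}\frac{1}{[v-i+l(\mu)]},\qquad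 \mathcal{W}_{\mu\nu}=\mathcal{W}_{\mu,\nu}=\mathcal{W}_\mu\, s_\nu(q^{\mu+\rho}).$$ Define $K_{\mu^1\mu^2}(Q)=\sum_{\nu}Q^{|\nu|}\mathcal{W}_{\mu^1\nu}\mathcal{W}_{\nu\mu^2}$, the sum over all partitions $\nu$, a formal power series in $Q$. Define $f_{\mu^1\mu^2}(q)=q\left(\sum_{i\ge1}q^{\mu^1_i-i}\sum_{j\ge1}q^{\mu^2_j-j}-\sum_{i\ge1}q^{-i}\sum_{j\ge1}q^{-j}\right)$ (series summed for $|q|>1$). This is a Laurent polynomial in $q$ with integer coefficients, and $C_k(\mu^1,\mu^2)$ denotes its coefficients: $f_{\mu^1\mu^2}(q)=\sum_k C_k(\mu^1,\mu^2)q^k$, $k\in\mathbb{Z}$. *)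

theory Defs
  imports
    Complex_Main
    "HOL-Computational_Algebra.Formal_Laurent_Series"
    "Jordan_Normal_Form.Determinant"
begin

text \<open>
  A partition is a nonincreasing sequence of naturals with finitely many nonzero terms. Sequences
  are indexed from 0: the part usually written with index \<open>i \<ge> 1\<close> is \<open>\<mu> (i - 1)\<close>. The empty
  partition is \<open>\<lambda>_. 0\<close>.
\<close>

definition is_partition :: "(nat \<Rightarrow> nat) \<Rightarrow> bool" where
  "is_partition \<mu> \<longleftrightarrow> antimono \<mu> \<and> finite {i. \<mu> i \<noteq> 0}"

abbreviation empty_part :: "nat \<Rightarrow> nat" where
  "empty_part \<equiv> (\<lambda>_. 0)"

definition plen :: "(nat \<Rightarrow> nat) \<Rightarrow> nat" where
  "plen \<mu> = card {i. \<mu> i \<noteq> 0}"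

definition psize :: "(nat \<Rightarrow> nat) \<Rightarrow> nat" where
  "psize \<mu> = (\<Sum>i<plen \<mu>. \<mu> i)"

definition kappa :: "(nat \<Rightarrow> nat) \<Rightarrow> int" where
  "kappa \<mu> = (\<Sum>i<plen \<mu>. int (\<mu> i) * (int (\<mu> i) - 2 * int (i + 1) + 1))"

text \<open>Hence \<open>q\<close> to the power \<open>kappa \<mu> / 4\<close> is the integral power \<open>kappa \<mu> div 2\<close> of \<open>q\<^sup>1\<^sup>/\<^sup>2\<close>.\<close>

lemma even_kappa: "even (kappa \<mu>)"
  unfolding kappa_def by (rule dvd_sum) auto

text \<open>
  Rational functions of \<open>q\<^sup>1\<^sup>/\<^sup>2\<close> are represented by their Laurent expansions at \<open>q = \<infinity>\<close> (the
  expansions valid for large \<open>\<bar>q\<bar>\<close>), that is, inside the field of formal Laurent series with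
  rational coefficients in the variable \<open>fls_X = q\<^sup>-\<^sup>1\<^sup>/\<^sup>2\<close>; the expansion map is an injective field
  homomorphism. Series in \<open>q\<close> that are summed for \<open>\<bar>q\<bar> > 1\<close> are sums in the topology of this field.
\<close>

definition qhalf :: "rat fls" where
  "qhalf = fls_X_inv"

definition q :: "rat fls" where
  "q = qhalf ^ 2"

definition qbracket :: "int \<Rightarrow> rat fls" where
  "qbracket m = qhalf powi m - qhalf powi (- m)"

definition W1 :: "(nat \<Rightarrow> nat) \<Rightarrow> rat fls" where
  "W1 \<mu> = qhalf powi (kappa \<mu> div 2)
     * (\<Prod>j<plen \<mu>. \<Prod>i<j.
          qbracket (int (\<mu> i) - int (\<mu> j) + int j - int i) / qbracket (int j - int i))
     * (\<Prod>i<plen \<mu>. \<Prod>v=1..\<mu> i. 1 / qbracket (int v - int (i + 1) + int (plen \<mu>)))"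

text \<open>
  The Schur polynomial in the variables \<open>x 0, \<dots>, x (N - 1)\<close>, evaluated at pairwise distinct
  elements of a field, as the quotient of alternants (Jacobi's bialternant formula). It vanishes
  when there are fewer variables than parts.
\<close>

definition schur_poly :: "nat \<Rightarrow> (nat \<Rightarrow> nat) \<Rightarrow> (nat \<Rightarrow> 'a::field) \<Rightarrow> 'a" where
  "schur_poly N \<nu> x =
     (if plen \<nu> \<le> N
      then det (mat N N (\<lambda>(i, j). x i ^ (\<nu> j + (N - 1 - j))))
             / det (mat N N (\<lambda>(i, j). x i ^ (N - 1 - j)))
      else 0)"

text \<open>
  The point \<open>q\<^bsup>\<mu>+\<rho>\<^esup>\<close>: with the index shift, the exponent \<open>\<mu>\<^sub>i - i + 1/2\<close> becomes
  \<open>\<mu> i - i - 1/2\<close>. These exponents are strictly decreasing, so the coordinates are distinct.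
\<close>

definition q_shift :: "(nat \<Rightarrow> nat) \<Rightarrow> nat \<Rightarrow> rat fls" where
  "q_shift \<mu> i = qhalf powi (2 * (int (\<mu> i) - int i) - 1)"

text \<open>The Schur function in infinitely many variables is the limit of the Schur polynomials.\<close>

definition schur_eval :: "(nat \<Rightarrow> nat) \<Rightarrow> (nat \<Rightarrow> nat) \<Rightarrow> rat fls" where
  "schur_eval \<nu> \<mu> = lim (\<lambda>N. schur_poly N \<nu> (q_shift \<mu>))"

definition W2 :: "(nat \<Rightarrow> nat) \<Rightarrow> (nat \<Rightarrow> nat) \<Rightarrow> rat fls" where
  "W2 \<mu> \<nu> = W1 \<mu> * schur_eval \<nu> \<mu>"

definition K :: "(nat \<Rightarrow> nat) \<Rightarrow> (nat \<Rightarrow> nat) \<Rightarrow> rat fls fps" where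
  "K \<mu>1 \<mu>2 = Abs_fps (\<lambda>n. \<Sum>\<nu> | is_partition \<nu> \<and> psize \<nu> = n. W2 \<mu>1 \<nu> * W2 \<nu> \<mu>2)"

text \<open>The argument \<open>y\<close> is \<open>q\<close> or one of its powers \<open>q\<^sup>n\<close>, \<open>n \<ge> 1\<close>.\<close>

definition f :: "(nat \<Rightarrow> nat) \<Rightarrow> (nat \<Rightarrow> nat) \<Rightarrow> rat fls \<Rightarrow> rat fls" where
  "f \<mu>1 \<mu>2 y =
     y * ((\<Sum>i. y powi (int (\<mu>1 i) - int (i + 1))) * (\<Sum>j. y powi (int (\<mu>2 j) - int (j + 1)))
          - (\<Sum>i. y powi (- int (i + 1))) * (\<Sum>j. y powi (- int (j + 1))))"

text \<open>
  The coefficient of \<open>q\<^sup>k\<close> in \<open>f \<mu>1 \<mu>2 q\<close>, where \<open>q\<^sup>k\<close> is \<open>fls_X\<close> to the power \<open>-2k\<close>. The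
  coefficients are integers, so the floor only changes the type.
\<close>

definition C :: "(nat \<Rightarrow> nat) \<Rightarrow> (nat \<Rightarrow> nat) \<Rightarrow> int \<Rightarrow> int" where
  "C \<mu>1 \<mu>2 k = \<lfloor>fls_nth (f \<mu>1 \<mu>2 q) (- 2 * k)\<rfloor>"

end

theory Submission
  imports Defs
begin

text \<open>
  The pairing \<open>W2 \<mu> \<nu>\<close> is symmetric, so both factors in a summand of \<open>K \<mu>1 \<mu>2\<close> can be written with the
  summation index in the Schur function:
  \<open>W2 \<mu>1 \<nu> * W2 \<nu> \<mu>2 = W1 \<mu>1 * W1 \<mu>2 * s_\<nu>(q^(\<mu>1+\<rho>)) * s_\<nu>(q^(\<mu>2+\<rho>))\<close>. The sum over \<open>\<nu>\<close> is then
  the Cauchy kernel, the product of \<open>1 / (1 - Q x_i y_j)\<close> over the coordinates \<open>x_i\<close> and \<open>y_j\<close> of the two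
  points. Its logarithm is the sum of \<open>Q^n p_n(x) p_n(y) / n\<close>, and
  \<open>p_n(x) p_n(y) = y * A \<mu>1 y * A \<mu>2 y\<close> at \<open>y = q^n\<close>, where \<open>A \<mu> y\<close> is the sum over \<open>i\<close> of
  \<open>y powi (\<mu> i - i - 1)\<close> (\<open>shifted_sum\<close>). Dividing by the same expression for the empty partitions subtracts
  \<open>y * A 0 y * A 0 y\<close> in the exponent, which leaves exactly \<open>f \<mu>1 \<mu>2 (q ^ n)\<close> (\<open>K_eq_exp\<close>). Since
  \<open>f\<close> is a Laurent polynomial with integer coefficients (\<open>f_laurent_expansion\<close>), the exponential is a
  finite product of powers of \<open>1 - q^k Q\<close>.

  The definitions give Schur functions in infinitely many variables as limits of quotients of
  alternants in \<open>N\<close> variables, so each ingredient is an identity of determinants for fixed \<open>N\<close>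
  together with a passage to the limit in the field of Laurent series.

  \<^item> Existence of the limits. The factorization \<open>alternant_jacobi_trudi\<close> turns the bialternant into a
    determinant of complete symmetric polynomials whose size does not depend on \<open>N\<close>. The complete
    symmetric polynomials are polynomials in the power sums, and the power sums converge because they
    are geometric series up to finitely many terms.

  \<^item> The Cauchy identity. For fixed \<open>N\<close> the determinant of the matrix with entries
    \<open>1 / (1 - Q x_i y_j)\<close> is evaluated in two ways: in closed form (\<open>cauchy_determinant\<close>) and by
    expanding the geometric series, where the surviving exponent vectors are the permutations of
    \<open>\<nu> + \<delta>\<close> (\<open>cauchy_binet_geometric\<close>).

  \<^item> The symmetry. In the alternant at the point \<open>q^(\<mu>+\<rho>)\<close> every row and every column carries a
    power of \<open>q\<close>; after removing these, the entry is \<open>q\<close> to the power \<open>(\<mu> i - i) * (\<nu> j - j)\<close>, which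
    is symmetric in \<open>\<mu>\<close> and \<open>\<nu>\<close>. It follows that
    \<open>s_\<mu>(q^\<rho>) s_\<nu>(q^(\<mu>+\<rho>))\<close> is symmetric (\<open>schur_eval_symmetry\<close>), and \<open>W1 \<mu>\<close> is \<open>s_\<mu>(q^\<rho>)\<close>
    because the alternant at \<open>q^\<rho>\<close> is a Vandermonde determinant (\<open>W1_eq_schur_eval\<close>).
\<close>

(* The dollar sign denotes coefficients of formal power series throughout, not vector entries. *)
no_notation vec_index (infixl "$" 100)

section \<open>Convergence of Laurent series\<close>

lemma fls_dist_less_iff:
  fixes a b :: "'a::group_add fls"
  shows "dist a b < inverse (2 ^ m) \<longleftrightarrow> (\<forall>i\<le>int m. fls_nth (a - b) i = 0)"
proof (cases "a = b")
  case False
  then have ab: "a - b \<noteq> 0" by simp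
  have *: "(\<forall>i\<le>int m. fls_nth (a - b) i = 0) \<longleftrightarrow> int m < fls_subdegree (a - b)"
  proof
    assume "\<forall>i\<le>int m. fls_nth (a - b) i = 0"
    then show "int m < fls_subdegree (a - b)"
      using fls_subdegree_greaterI[OF ab] by (metis ab nth_fls_subdegree_nonzero not_le)
  next
    assume "int m < fls_subdegree (a - b)"
    then show "\<forall>i\<le>int m. fls_nth (a - b) i = 0"
      by (intro allI impI fls_eq0_below_subdegree) simp
  qed
  show ?thesis
  proof (cases "fls_subdegree (a - b) \<ge> 0")
    case True
    then show ?thesis unfolding * using False by (simp add: dist_fls_def zless_nat_eq_int_zless)
  next
    case neg: False
    have "inverse ((2::real) ^ m) \<le> 1" by (simp add: inverse_le_1_iff)
    also have "\<dots> \<le> 2 ^ nat (- fls_subdegree (a - b))" by simp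
    finally show ?thesis unfolding * using False neg by (simp add: dist_fls_def)
  qed
qed simp

text \<open>
  Convergence in the Laurent series metric means that, for every bound \<open>k\<close>, eventually all coefficients
  below \<open>k\<close> agree at the same time. Coefficientwise convergence is weaker, since it allows poles of
  growing order.
\<close>

lemma fls_tendsto_iff:
  fixes X :: "'b \<Rightarrow> 'a::group_add fls"
  shows "(X \<longlongrightarrow> L) F \<longleftrightarrow> (\<forall>k. eventually (\<lambda>n. \<forall>i<k. fls_nth (X n - L) i = 0) F)"
proof
  assume lim: "(X \<longlongrightarrow> L) F"
  show "\<forall>k. eventually (\<lambda>n. \<forall>i<k. fls_nth (X n - L) i = 0) F"
  proof
    fix k :: int
    have "eventually (\<lambda>n. dist (X n) L < inverse (2 ^ nat k)) F"
      using lim by (rule tendstoD) simp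
    then show "eventually (\<lambda>n. \<forall>i<k. fls_nth (X n - L) i = 0) F"
      by (rule eventually_mono) (auto simp: fls_dist_less_iff)
  qed
next
  assume ev: "\<forall>k. eventually (\<lambda>n. \<forall>i<k. fls_nth (X n - L) i = 0) F"
  show "(X \<longlongrightarrow> L) F"
  proof (rule tendstoI)
    fix e :: real assume "0 < e"
    then obtain m where m: "inverse (2 ^ m) < e"
      using real_arch_pow_inv[of e "1/2"] by (auto simp: power_divide field_simps)
    from ev have "eventually (\<lambda>n. \<forall>i<int m + 1. fls_nth (X n - L) i = 0) F" by blast
    then show "eventually (\<lambda>n. dist (X n) L < e) F"
    proof (rule eventually_mono)
      fix n assume "\<forall>i<int m + 1. fls_nth (X n - L) i = 0"
      then have "dist (X n) L < inverse (2 ^ m)" by (simp add: fls_dist_less_iff)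
      then show "dist (X n) L < e" using m by simp
    qed
  qed
qed

text \<open>
  Stated with vanishing coefficients instead of \<open>fls_subdegree\<close>, because the subdegree of the zero
  series is 0 and would force case distinctions in the continuity proofs.
\<close>

lemma fls_mult_nth_eq_0:
  fixes f g :: "'a::comm_ring_1 fls"
  assumes "\<forall>i<a. fls_nth f i = 0" "\<forall>i<b. fls_nth g i = 0" "i < a + b"
  shows "fls_nth (f * g) i = 0"
proof (cases "f = 0 \<or> g = 0")
  case False
  then have "a \<le> fls_subdegree f" "b \<le> fls_subdegree g"
    using assms by (auto intro!: fls_subdegree_geI)
  then show ?thesis using assms(3) by (intro fls_times_nth_eq0) linarith
qed auto

text \<open>
  With these two instances the general limit rules for finite sums and products, and hence for
  determinants, apply to Laurent series.
\<close>

instance fls :: (comm_ring_1) topological_comm_monoid_add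
proof
  fix a b :: "'a fls"
  have "((\<lambda>x. fst x) \<longlongrightarrow> a) (nhds a \<times>\<^sub>F nhds b)" "((\<lambda>x. snd x) \<longlongrightarrow> b) (nhds a \<times>\<^sub>F nhds b)"
    by (simp_all add: filterlim_def filtermap_fst_prod_filter filtermap_snd_prod_filter)
  then show "((\<lambda>x. fst x + snd x) \<longlongrightarrow> a + b) (nhds a \<times>\<^sub>F nhds b)"
    unfolding fls_tendsto_iff
  proof -
    assume *: "\<forall>k. eventually (\<lambda>x. \<forall>i<k. fls_nth (fst x - a) i = 0) (nhds a \<times>\<^sub>F nhds b)"
      "\<forall>k. eventually (\<lambda>x. \<forall>i<k. fls_nth (snd x - b) i = 0) (nhds a \<times>\<^sub>F nhds b)"
    show "\<forall>k. eventually (\<lambda>x. \<forall>i<k. fls_nth (fst x + snd x - (a + b)) i = 0) (nhds a \<times>\<^sub>F nhds b)"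
    proof
      fix k :: int
      show "eventually (\<lambda>x. \<forall>i<k. fls_nth (fst x + snd x - (a + b)) i = 0) (nhds a \<times>\<^sub>F nhds b)"
        using *(1)[rule_format, of k] *(2)[rule_format, of k] by eventually_elim simp
    qed
  qed
qed

instance fls :: (comm_ring_1) topological_comm_monoid_mult
proof
  fix a b :: "'a fls"
  have lim: "((\<lambda>x. fst x) \<longlongrightarrow> a) (nhds a \<times>\<^sub>F nhds b)" "((\<lambda>x. snd x) \<longlongrightarrow> b) (nhds a \<times>\<^sub>F nhds b)"
    by (simp_all add: filterlim_def filtermap_fst_prod_filter filtermap_snd_prod_filter)
  show "((\<lambda>x. fst x * snd x) \<longlongrightarrow> a * b) (nhds a \<times>\<^sub>F nhds b)"
    unfolding fls_tendsto_iff
  proof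
    fix k :: int
    define K where "K = max 0 k"
    \<comment> \<open>The factors \<open>a\<close> and \<open>b\<close> may have poles, which cost precision in the mixed products.\<close>
    define A where "A = min 0 (fls_subdegree a)"
    define B where "B = min 0 (fls_subdegree b)"
    have "eventually (\<lambda>x. \<forall>i<K - B. fls_nth (fst x - a) i = 0) (nhds a \<times>\<^sub>F nhds b)"
      "eventually (\<lambda>x. \<forall>i<K - A. fls_nth (snd x - b) i = 0) (nhds a \<times>\<^sub>F nhds b)"
      using lim unfolding fls_tendsto_iff by blast+
    then show "eventually (\<lambda>x. \<forall>i<k. fls_nth (fst x * snd x - a * b) i = 0) (nhds a \<times>\<^sub>F nhds b)"
    proof eventually_elim
      case (elim x)
      have a0: "\<forall>i<A. fls_nth a i = 0" and b0: "\<forall>i<B. fls_nth b i = 0"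
        by (auto simp: A_def B_def)
      have "fls_nth (fst x * snd x - a * b) i = 0" if "i < k" for i
      proof -
        have split: "fst x * snd x - a * b = (fst x - a) * (snd x - b) + (a * (snd x - b) + (fst x - a) * b)"
          by (simp add: algebra_simps)
        have "fls_nth ((fst x - a) * (snd x - b)) i = 0" "fls_nth (a * (snd x - b)) i = 0"
          "fls_nth ((fst x - a) * b) i = 0"
          using that by (auto intro!: fls_mult_nth_eq_0[OF elim] fls_mult_nth_eq_0[OF a0 elim(2)]
              fls_mult_nth_eq_0[OF elim(1) b0] simp: K_def A_def B_def)
        then show ?thesis unfolding split by simp
      qed
      then show ?case by blast
    qed
  qed
qed

section \<open>Power series with prescribed logarithmic derivative\<close>

lemma geometric_series_inverse:
  fixes c :: "'a::comm_ring_1"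
  shows "(1 - fps_const c * fps_X) * Abs_fps (\<lambda>n. c ^ n) = 1" (is "?l = 1")
proof (rule fps_ext)
  fix n
  have "?l = Abs_fps (\<lambda>n. c ^ n) - fps_const c * (Abs_fps (\<lambda>n. c ^ n) * fps_X)"
    by (simp add: algebra_simps)
  then have "?l $ n = c ^ n - (if n = 0 then 0 else c * c ^ (n - 1))" by simp
  then show "?l $ n = 1 $ n" by (cases n) auto
qed

text \<open>
  The exponential of the sum of \<open>a n * X ^ n / n\<close> over \<open>n \<ge> 1\<close>. With power sums for \<open>a n\<close> this is the
  generating function of the complete symmetric functions.
\<close>

definition plexp :: "(nat \<Rightarrow> 'a::field_char_0) \<Rightarrow> 'a fps" where
  "plexp a = fps_exp 1 oo Abs_fps (\<lambda>n. if n = 0 then 0 else a n / of_nat n)"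

lemma plexp_nth_0 [simp]: "plexp a $ 0 = 1"
  by (simp add: plexp_def fps_compose_nth)

lemma deriv_plexp: "fps_deriv (plexp a) = plexp a * Abs_fps (\<lambda>n. a (Suc n))"
proof -
  have "fps_deriv (Abs_fps (\<lambda>n. if n = 0 then 0 else a n / of_nat n)) = Abs_fps (\<lambda>n. a (Suc n))"
    by (rule fps_ext) (simp del: of_nat_Suc)
  then show ?thesis
    unfolding plexp_def by (subst fps_compose_deriv) (auto simp: fps_exp_deriv)
qed

lemma logderiv_recurrence:
  fixes F :: "'a::field_char_0 fps"
  assumes "fps_deriv F = F * Abs_fps (\<lambda>n. a (Suc n))"
  shows "F $ Suc n = (\<Sum>i=0..n. F $ i * a (Suc (n - i))) / of_nat (Suc n)"
proof -
  have "of_nat (Suc n) * F $ Suc n = fps_deriv F $ n" by simp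
  also have "\<dots> = (\<Sum>i=0..n. F $ i * a (Suc (n - i)))"
    unfolding assms by (simp add: fps_mult_nth)
  finally show ?thesis by (simp add: field_simps del: of_nat_Suc)
qed

lemma plexp_recurrence:
  "plexp a $ Suc n = (\<Sum>i=0..n. plexp a $ i * a (Suc (n - i))) / of_nat (Suc n)"
  by (rule logderiv_recurrence) (rule deriv_plexp)

text \<open>
  \<open>plexp a\<close> is characterized by its constant term and its logarithmic derivative, because the
  differential equation determines the coefficients recursively. The multiplicative rules below and
  the limit theorem rest on this characterization, not on manipulations of the composition.
\<close>

lemma plexp_unique:
  fixes F :: "'a::field_char_0 fps"
  assumes "F $ 0 = 1" "fps_deriv F = F * Abs_fps (\<lambda>n. a (Suc n))"
  shows "F = plexp a"
proof (rule fps_ext)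
  fix n
  show "F $ n = plexp a $ n"
  proof (induction n rule: less_induct)
    case (less n)
    show ?case
    proof (cases n)
      case (Suc m)
      have "(\<Sum>i=0..m. F $ i * a (Suc (m - i))) = (\<Sum>i=0..m. plexp a $ i * a (Suc (m - i)))"
        using less Suc by (intro sum.cong) auto
      then show ?thesis
        unfolding Suc logderiv_recurrence[of F a, OF assms(2)] plexp_recurrence by simp
    qed (use assms in simp)
  qed
qed

lemma plexp_add: "plexp (\<lambda>n. a n + b n) = plexp a * plexp b"
proof (rule plexp_unique[symmetric])
  have "Abs_fps (\<lambda>n. a (Suc n) + b (Suc n)) = Abs_fps (\<lambda>n. a (Suc n)) + Abs_fps (\<lambda>n. b (Suc n))"
    by (rule fps_ext) simp
  then show "fps_deriv (plexp a * plexp b) = plexp a * plexp b * Abs_fps (\<lambda>n. a (Suc n) + b (Suc n))"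
    by (simp add: deriv_plexp algebra_simps)
qed simp

lemma plexp_zero: "plexp (\<lambda>n. 0) = 1"
  by (rule plexp_unique[symmetric]) (auto simp: fps_eq_iff fps_mult_nth)

lemma plexp_cong: "(\<And>n. n \<ge> 1 \<Longrightarrow> a n = b n) \<Longrightarrow> plexp a = plexp b"
  unfolding plexp_def by (intro arg_cong2[of _ _ _ _ fps_compose] refl fps_ext) auto

lemma plexp_sum: "plexp (\<lambda>n. \<Sum>i\<in>I. a i n) = (\<Prod>i\<in>I. plexp (a i))"
  by (induction I rule: infinite_finite_induct) (simp_all add: plexp_zero plexp_add)

text \<open>
  The case of a single variable \<open>c\<close>, whose power sums are \<open>c ^ n\<close>.
\<close>

lemma plexp_power:
  "plexp (\<lambda>n. c ^ n) = Abs_fps (\<lambda>n. c ^ n)"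
proof (rule plexp_unique[symmetric])
  show "fps_deriv (Abs_fps (\<lambda>n. c ^ n)) = Abs_fps (\<lambda>n. c ^ n) * Abs_fps (\<lambda>n. c ^ Suc n)"
    by (rule fps_ext) (simp add: fps_mult_nth flip: power_add power_Suc)
qed simp

lemma plexp_power_eq_inverse: "plexp (\<lambda>n. c ^ n) = inverse (1 - fps_const c * fps_X)"
  using fps_inverse_unique[OF geometric_series_inverse[of c]] by (simp add: plexp_power)

lemma plexp_of_nat: "plexp (\<lambda>n. of_nat m * a n) = plexp a ^ m"
  by (induction m) (simp_all add: plexp_zero plexp_add algebra_simps)

lemma plexp_uminus: "plexp (\<lambda>n. - a n) = inverse (plexp a)"
proof -
  have "plexp (\<lambda>n. - a n) * plexp a = 1"
    by (subst plexp_add[symmetric]) (simp add: plexp_zero)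
  then show ?thesis by (metis fps_inverse_unique mult.commute)
qed

lemma plexp_of_int_power:
  "plexp (\<lambda>n. of_int m * c ^ n) = (1 - fps_const c * fps_X) powi (- m)"
proof (cases "m \<ge> 0")
  case True
  then have "(of_int m :: 'a) = of_nat (nat m)" by simp
  then have "plexp (\<lambda>n. of_int m * c ^ n) = plexp (\<lambda>n. c ^ n) ^ nat m"
    by (simp only: plexp_of_nat)
  then show ?thesis using True
    by (cases "m = 0") (simp_all add: power_int_def plexp_power_eq_inverse)
next
  case False
  then have m: "(of_int m :: 'a) = - of_nat (nat (- m))" by simp
  have "plexp (\<lambda>n. of_int m * c ^ n) = inverse (plexp (\<lambda>n. of_nat (nat (- m)) * c ^ n))"
    unfolding m by (simp add: plexp_uminus)
  also have "\<dots> = (inverse (inverse (1 - fps_const c * fps_X))) ^ nat (- m)"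
    by (simp add: plexp_of_nat fps_inverse_power plexp_power_eq_inverse)
  finally show ?thesis using False by (simp add: power_int_def fps_inverse_idempotent)
qed

text \<open>
  Each coefficient of \<open>plexp a\<close> is a polynomial in finitely many of the \<open>a k\<close>, by the recurrence; so no
  uniformity in \<open>k\<close> is required of the convergence.
\<close>

lemma tendsto_plexp_nth:
  fixes a :: "nat \<Rightarrow> 'b::field_char_0 fls"
  assumes "\<And>k. k \<ge> 1 \<Longrightarrow> (\<lambda>N. A N k) \<longlonglongrightarrow> a k"
  shows "(\<lambda>N. plexp (A N) $ n) \<longlonglongrightarrow> plexp a $ n"
proof (induction n rule: less_induct)
  case (less n)
  show ?case
  proof (cases n)
    case (Suc m)
    have "(\<lambda>N. (\<Sum>i=0..m. plexp (A N) $ i * A N (Suc (m - i))) * inverse (of_nat (Suc m)))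
      \<longlonglongrightarrow> (\<Sum>i=0..m. plexp a $ i * a (Suc (m - i))) * inverse (of_nat (Suc m))"
      using less Suc assms by (intro tendsto_intros) auto
    then show ?thesis
      unfolding Suc plexp_recurrence divide_inverse .
  qed simp
qed

section \<open>Alternants, the Jacobi-Trudi formula and the Cauchy determinant\<close>

definition alternant :: "nat \<Rightarrow> (nat \<Rightarrow> nat) \<Rightarrow> (nat \<Rightarrow> 'a::comm_ring_1) \<Rightarrow> 'a" where
  "alternant N \<alpha> x = det (mat N N (\<lambda>(i, j). x i ^ \<alpha> j))"

text \<open>
  The vector usually written \<open>\<delta> = (N - 1, \<dots>, 1, 0)\<close>, whose alternant is the Vandermonde determinant.
\<close>

definition staircase :: "nat \<Rightarrow> nat \<Rightarrow> nat" where
  "staircase N j = N - 1 - j"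

abbreviation vandermonde :: "nat \<Rightarrow> (nat \<Rightarrow> 'a::comm_ring_1) \<Rightarrow> 'a" where
  "vandermonde N \<equiv> alternant N (staircase N)"

lemma det_mat_eq:
  "det (mat N N m) = (\<Sum>p | p permutes {0..<N}. signof p * (\<Prod>i=0..<N. m (i, p i)))"
  by (subst det_def'[where n = N]) (auto intro!: sum.cong prod.cong simp: permutes_in_image
      dest: permutes_in_image)

lemma det_mat_cong:
  "(\<And>i j. i < N \<Longrightarrow> j < N \<Longrightarrow> m (i, j) = m' (i, j)) \<Longrightarrow> det (mat N N m) = det (mat N N m')"
  by (rule arg_cong[of _ _ det]) auto

lemma det_scale:
  fixes m :: "nat \<Rightarrow> nat \<Rightarrow> 'a::comm_ring_1"
  shows "det (mat N N (\<lambda>(i, j). r i * c j * m i j))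
       = (\<Prod>i<N. r i) * (\<Prod>j<N. c j) * det (mat N N (\<lambda>(i, j). m i j))"
proof -
  have "(\<Prod>i=0..<N. r i * c (p i) * m i (p i)) = (\<Prod>i<N. r i) * (\<Prod>j<N. c j) * (\<Prod>i=0..<N. m i (p i))"
    if "p permutes {0..<N}" for p
    using prod.permute[OF that, of c]
    by (simp add: prod.distrib lessThan_atLeast0)
  then show ?thesis
    unfolding det_mat_eq by (simp add: sum_distrib_left algebra_simps)
qed

lemma det_transpose_mat: "det (mat N N (\<lambda>(i, j). m i j)) = det (mat N N (\<lambda>(i, j). m j i))"
  by (subst det_transpose[symmetric, of _ N])
     (auto intro!: arg_cong[of _ _ det])

lemma det_product:
  fixes a b :: "nat \<Rightarrow> nat \<Rightarrow> 'a::comm_ring_1"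
  shows "det (mat N N (\<lambda>(i, j). \<Sum>k<N. a i k * b k j))
       = det (mat N N (\<lambda>(i, j). a i j)) * det (mat N N (\<lambda>(i, j). b i j))"
proof -
  have "mat N N (\<lambda>(i, j). \<Sum>k<N. a i k * b k j) = mat N N (\<lambda>(i, j). a i j) * mat N N (\<lambda>(i, j). b i j)"
    by (auto simp: scalar_prod_def lessThan_atLeast0)
  then show ?thesis by (simp add: det_mult[of _ N])
qed

text \<open>
  The coefficients of this polynomial are, up to sign, the elementary symmetric polynomials in the
  variables other than \<open>x i\<close>.
\<close>

definition omit_poly :: "nat \<Rightarrow> (nat \<Rightarrow> 'a::comm_ring_1) \<Rightarrow> nat \<Rightarrow> 'a poly" where
  "omit_poly N x i = (\<Prod>l\<in>{..<N} - {i}. [:1, - x l:])"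

lemma degree_omit_poly:
  assumes "i < N"
  shows "degree (omit_poly N x i) < N"
proof -
  have "degree (omit_poly N x i) \<le> (\<Sum>l\<in>{..<N} - {i}. degree [:1, - x l:])"
    unfolding omit_poly_def by (intro degree_prod_sum_le[unfolded o_def]) auto
  also have "\<dots> \<le> (\<Sum>l\<in>{..<N} - {i}. 1)" by (intro sum_mono) auto
  also have "\<dots> < N" using assms by (simp add: card_Diff_singleton)
  finally show ?thesis .
qed

lemma poly_omit_poly: "poly (omit_poly N x i) t = (\<Prod>l\<in>{..<N} - {i}. 1 - x l * t)"
  by (simp add: omit_poly_def poly_prod mult.commute)

lemma poly_omit_poly_sum:
  assumes "i < N"
  shows "(\<Prod>l\<in>{..<N} - {i}. 1 - x l * t) = (\<Sum>k<N. coeff (omit_poly N x i) (N - 1 - k) * t ^ (N - 1 - k))"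
proof -
  have "(\<Prod>l\<in>{..<N} - {i}. 1 - x l * t) = (\<Sum>k\<le>degree (omit_poly N x i). coeff (omit_poly N x i) k * t ^ k)"
    by (simp add: poly_altdef flip: poly_omit_poly)
  also have "\<dots> = (\<Sum>k<N. coeff (omit_poly N x i) k * t ^ k)"
    using degree_omit_poly[OF assms, of x]
    by (intro sum.mono_neutral_left) (auto simp: coeff_eq_0)
  also have "\<dots> = (\<Sum>k<N. coeff (omit_poly N x i) (N - 1 - k) * t ^ (N - 1 - k))"
    by (rule sum.nat_diff_reindex[symmetric, of _ N, unfolded diff_Suc_eq_diff_pred])
  finally show ?thesis .
qed

text \<open>
  The generating function of the complete symmetric polynomials in \<open>x 0, \<dots>, x (N - 1)\<close>.
\<close>

definition complete_fps :: "nat \<Rightarrow> (nat \<Rightarrow> 'a::comm_ring_1) \<Rightarrow> 'a fps" where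
  "complete_fps N x = (\<Prod>l<N. Abs_fps (\<lambda>k. x l ^ k))"

text \<open>
  Coefficients with negative index are zero, as the Jacobi-Trudi determinant requires.
\<close>

definition fps_nth_int :: "'a::zero fps \<Rightarrow> int \<Rightarrow> 'a" where
  "fps_nth_int F m = (if m < 0 then 0 else F $ nat m)"

lemma omit_poly_complete:
  assumes "i < N"
  shows "fps_of_poly (omit_poly N x i) * complete_fps N x = Abs_fps (\<lambda>k. x i ^ k)"
proof -
  have *: "{..<N} = insert i ({..<N} - {i})" using assms by auto
  have "complete_fps N x = Abs_fps (\<lambda>k. x i ^ k) * (\<Prod>l\<in>{..<N} - {i}. Abs_fps (\<lambda>k. x l ^ k))"
    unfolding complete_fps_def by (subst *, subst prod.insert) auto
  moreover have "fps_of_poly (omit_poly N x i) = (\<Prod>l\<in>{..<N} - {i}. 1 - fps_const (x l) * fps_X)"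
    unfolding omit_poly_def fps_of_poly_prod
    by (intro prod.cong refl) (simp add: fps_of_poly_linear' flip: fps_const_neg)
  moreover have "(\<Prod>l\<in>{..<N} - {i}. 1 - fps_const (x l) * fps_X)
      * (\<Prod>l\<in>{..<N} - {i}. Abs_fps (\<lambda>k. x l ^ k)) = 1"
    by (subst prod.distrib[symmetric]) (simp add: geometric_series_inverse)
  ultimately show ?thesis by (simp add: algebra_simps)
qed

text \<open>
  Multiplying the generating function of the complete symmetric polynomials by \<open>omit_poly\<close> cancels
  all its factors except the geometric series of \<open>x i\<close>. Reading off the coefficient of degree \<open>a\<close> writes
  the matrix of powers \<open>x i ^ a\<close> as a product, with one factor that does not depend on the exponents and
  another that does not depend on the row. The sum runs backwards through the coefficients so that for
  the staircase exponents the second factor becomes unitriangular.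
\<close>

lemma power_eq_omit_complete:
  assumes "i < N"
  shows "x i ^ a = (\<Sum>k<N. coeff (omit_poly N x i) (N - 1 - k)
                     * fps_nth_int (complete_fps N x) (int a - int (N - 1) + int k))"
proof -
  have "x i ^ a = (\<Sum>k=0..a. coeff (omit_poly N x i) k * complete_fps N x $ (a - k))"
    using arg_cong[OF omit_poly_complete[OF assms, of x], of "\<lambda>F. F $ a"] by (simp add: fps_mult_nth)
  also have "\<dots> = (\<Sum>k=0..a. coeff (omit_poly N x i) k * fps_nth_int (complete_fps N x) (int a - int k))"
    by (intro sum.cong) (auto simp: fps_nth_int_def nat_diff_distrib)
  also have "\<dots> = (\<Sum>k<N. coeff (omit_poly N x i) k * fps_nth_int (complete_fps N x) (int a - int k))"
  proof (rule sum.mono_neutral_cong)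
    show "coeff (omit_poly N x i) k * fps_nth_int (complete_fps N x) (int a - int k) = 0"
      if "k \<in> {0..a} - {..<N}" for k
      using that degree_omit_poly[OF assms, of x] by (auto simp: coeff_eq_0)
  qed (auto simp: fps_nth_int_def)
  also have "\<dots> = (\<Sum>k<N. coeff (omit_poly N x i) (N - 1 - k)
                   * fps_nth_int (complete_fps N x) (int a - int (N - 1 - k)))"
    by (rule sum.nat_diff_reindex[symmetric, of _ N, unfolded diff_Suc_eq_diff_pred])
  also have "\<dots> = (\<Sum>k<N. coeff (omit_poly N x i) (N - 1 - k)
                   * fps_nth_int (complete_fps N x) (int a - int (N - 1) + int k))"
    by (intro sum.cong refl) (simp add: of_nat_diff algebra_simps)
  finally show ?thesis .
qed

definition omit_det :: "nat \<Rightarrow> (nat \<Rightarrow> 'a::comm_ring_1) \<Rightarrow> 'a" where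
  "omit_det N x = det (mat N N (\<lambda>(i, k). coeff (omit_poly N x i) (N - 1 - k)))"

definition jacobi_trudi :: "nat \<Rightarrow> (nat \<Rightarrow> nat) \<Rightarrow> 'a::comm_ring_1 fps \<Rightarrow> 'a" where
  "jacobi_trudi N \<nu> H = det (mat N N (\<lambda>(k, j). fps_nth_int H (int (\<nu> j) - int j + int k)))"

lemma alternant_eq_omit_det:
  "alternant N (\<lambda>j. \<nu> j + staircase N j) x = omit_det N x * jacobi_trudi N \<nu> (complete_fps N x)"
  unfolding alternant_def omit_det_def jacobi_trudi_def det_product[symmetric]
proof (rule det_mat_cong, unfold prod.case)
  fix i j assume ij: "i < N" "j < N"
  then have *: "int (\<nu> j + staircase N j) - int (N - 1) = int (\<nu> j) - int j"
    by (simp add: staircase_def of_nat_diff)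
  show "x i ^ (\<nu> j + staircase N j) = (\<Sum>k<N. coeff (omit_poly N x i) (N - 1 - k)
      * fps_nth_int (complete_fps N x) (int (\<nu> j) - int j + int k))"
    using power_eq_omit_complete[OF ij(1), of x "\<nu> j + staircase N j"] unfolding * .
qed

text \<open>
  A zero part contributes a last column which is zero except for a one on the diagonal.
\<close>

lemma jacobi_trudi_Suc:
  assumes "\<nu> N = 0" "H $ 0 = 1"
  shows "jacobi_trudi (Suc N) \<nu> H = jacobi_trudi N \<nu> H"
proof -
  let ?A = "mat (Suc N) (Suc N) (\<lambda>(k, j). fps_nth_int H (int (\<nu> j) - int j + int k))"
  have "jacobi_trudi (Suc N) \<nu> H = (\<Sum>i<Suc N. ?A $$ (i, N) * cofactor ?A i N)"
    unfolding jacobi_trudi_def by (rule laplace_expansion_column) auto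
  also have "\<dots> = cofactor ?A N N"
    using assms by (subst sum.lessThan_Suc) (auto simp: fps_nth_int_def)
  also have "\<dots> = det (mat_delete ?A N N)" by (simp add: cofactor_def)
  also have "mat_delete ?A N N = mat N N (\<lambda>(k, j). fps_nth_int H (int (\<nu> j) - int j + int k))"
    by (auto simp: mat_delete_def)
  finally show ?thesis by (simp add: jacobi_trudi_def)
qed

lemma jacobi_trudi_stable:
  assumes "\<And>j. l \<le> j \<Longrightarrow> \<nu> j = 0" "H $ 0 = 1" "l \<le> N"
  shows "jacobi_trudi N \<nu> H = jacobi_trudi l \<nu> H"
  using assms(3)
proof (induction N rule: dec_induct)
  case (step n)
  then show ?case using assms jacobi_trudi_Suc[of \<nu> n H] by simp
qed simp

lemma complete_fps_nth_0 [simp]: "complete_fps N x $ 0 = 1"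
  by (induction N) (auto simp: complete_fps_def)

lemma vandermonde_eq_omit_det: "vandermonde N x = omit_det N x"
proof -
  have "jacobi_trudi N (\<lambda>_. 0) (complete_fps N x) = 1"
    by (subst jacobi_trudi_stable[of 0]) (auto simp: jacobi_trudi_def)
  then show ?thesis using alternant_eq_omit_det[of N "\<lambda>_. 0" x] by simp
qed

text \<open>
  The Jacobi-Trudi formula without division. For \<open>\<nu> = 0\<close> the second factor is 1, which identifies the
  determinant of the \<open>omit_poly\<close> coefficients with the Vandermonde determinant.
\<close>

lemma alternant_jacobi_trudi:
  "alternant N (\<lambda>j. \<nu> j + staircase N j) x = vandermonde N x * jacobi_trudi N \<nu> (complete_fps N x)"
  by (simp add: vandermonde_eq_omit_det alternant_eq_omit_det)

text \<open>
  The entry is the value of \<open>omit_poly N x i\<close> at \<open>y j\<close>, so the matrix factors into the coefficient matrix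
  already identified with the Vandermonde determinant of \<open>x\<close> and a matrix of powers of \<open>y\<close>.
\<close>

lemma det_omit_products:
  fixes x y :: "nat \<Rightarrow> 'a::comm_ring_1"
  shows "det (mat N N (\<lambda>(i, j). \<Prod>l\<in>{..<N} - {i}. 1 - x l * y j)) = vandermonde N x * vandermonde N y"
proof -
  have "det (mat N N (\<lambda>(i, j). \<Prod>l\<in>{..<N} - {i}. 1 - x l * y j))
      = det (mat N N (\<lambda>(i, j). \<Sum>k<N. coeff (omit_poly N x i) (N - 1 - k) * y j ^ (N - 1 - k)))"
    by (rule det_mat_cong) (simp add: poly_omit_poly_sum)
  also have "\<dots> = vandermonde N x * det (mat N N (\<lambda>(k, j). y j ^ (N - 1 - k)))"
    unfolding det_product vandermonde_eq_omit_det omit_det_def ..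
  also have "det (mat N N (\<lambda>(k, j). y j ^ (N - 1 - k))) = vandermonde N y"
    unfolding alternant_def staircase_def by (rule det_transpose_mat)
  finally show ?thesis .
qed

text \<open>
  \<open>G i j\<close> plays the role of \<open>1 / (1 - x i * y j)\<close>; taking it as a given inverse lets the lemma be used
  in rings of power series. Column \<open>j\<close> has the common factor \<open>\<Prod>l<N. G l j\<close>, and what remains of the
  entry is a product over \<open>l \<noteq> i\<close>.
\<close>

lemma cauchy_determinant:
  fixes x y :: "nat \<Rightarrow> 'a::comm_ring_1"
  assumes G: "\<And>i j. i < N \<Longrightarrow> j < N \<Longrightarrow> (1 - x i * y j) * G i j = 1"
  shows "det (mat N N (\<lambda>(i, j). G i j)) = vandermonde N x * vandermonde N y * (\<Prod>i<N. \<Prod>j<N. G i j)"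
proof -
  have "G i j = (\<Prod>l<N. G l j) * (\<Prod>l\<in>{..<N} - {i}. 1 - x l * y j)" if "i < N" "j < N" for i j
  proof -
    have *: "{..<N} = insert i ({..<N} - {i})" using that by auto
    have "(\<Prod>l<N. G l j) = G i j * (\<Prod>l\<in>{..<N} - {i}. G l j)"
      by (subst *, subst prod.insert) auto
    moreover have "(\<Prod>l\<in>{..<N} - {i}. G l j) * (\<Prod>l\<in>{..<N} - {i}. 1 - x l * y j) = 1"
      using G that by (subst prod.distrib[symmetric], intro prod.neutral) (auto simp: mult.commute)
    ultimately show ?thesis by (simp add: algebra_simps)
  qed
  then have "det (mat N N (\<lambda>(i, j). G i j))
      = det (mat N N (\<lambda>(i, j). 1 * (\<Prod>l<N. G l j) * (\<Prod>l\<in>{..<N} - {i}. 1 - x l * y j)))"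
    by (intro det_mat_cong) simp
  also have "\<dots> = (\<Prod>j<N. \<Prod>l<N. G l j) * (vandermonde N x * vandermonde N y)"
    by (subst det_scale) (simp add: det_omit_products)
  also have "(\<Prod>j<N. \<Prod>l<N. G l j) = (\<Prod>l<N. \<Prod>j<N. G l j)" by (rule prod.swap)
  finally show ?thesis by (simp add: algebra_simps)
qed

section \<open>Partitions and exponent vectors\<close>

lemma partition_eq_0_iff:
  assumes "is_partition \<mu>"
  shows "\<mu> i = 0 \<longleftrightarrow> plen \<mu> \<le> i"
proof -
  have anti: "antimono \<mu>" and fin: "finite {i. \<mu> i \<noteq> 0}"
    using assms by (auto simp: is_partition_def)
  obtain m0 where "\<mu> m0 = 0"
    using ex_new_if_finite[OF infinite_UNIV_nat fin] by auto
  \<comment> \<open>The support of a nonincreasing sequence is an initial segment.\<close>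
  define m where "m = (LEAST n. \<mu> n = 0)"
  have "\<mu> m = 0" unfolding m_def using \<open>\<mu> m0 = 0\<close> by (rule LeastI)
  then have "\<mu> i = 0" if "m \<le> i" for i
    using antimonoD[OF anti that] by simp
  moreover have "\<mu> i \<noteq> 0" if "i < m" for i
    using that unfolding m_def by (rule not_less_Least)
  ultimately have *: "\<mu> i \<noteq> 0 \<longleftrightarrow> i < m" for i
    by (cases "i < m") auto
  then have "{i. \<mu> i \<noteq> 0} = {..<m}" by auto
  then have "plen \<mu> = m" unfolding plen_def by simp
  then show ?thesis using *[of i] by auto
qed

lemma is_partition_empty: "is_partition (\<lambda>_. 0)"
  by (simp add: is_partition_def antimono_def)

lemma partition_antimono: "is_partition \<mu> \<Longrightarrow> i \<le> j \<Longrightarrow> \<mu> j \<le> \<mu> i"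
  by (simp add: is_partition_def antimonoD)

lemma psize_eq_sum:
  assumes "is_partition \<mu>" "plen \<mu> \<le> N"
  shows "psize \<mu> = (\<Sum>i<N. \<mu> i)"
  unfolding psize_def using assms partition_eq_0_iff[OF assms(1)]
  by (intro sum.mono_neutral_left) auto

lemma plen_le_psize:
  assumes "is_partition \<mu>"
  shows "plen \<mu> \<le> psize \<mu>"
proof -
  have "plen \<mu> = (\<Sum>i<plen \<mu>. 1)" by simp
  also have "\<dots> \<le> (\<Sum>i<plen \<mu>. \<mu> i)"
  proof (rule sum_mono)
    fix i assume "i \<in> {..<plen \<mu>}"
    then show "1 \<le> \<mu> i" using partition_eq_0_iff[OF assms, of i] by (cases "\<mu> i") auto
  qed
  finally show ?thesis by (simp add: psize_def)
qed

lemma plen_le_iff: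
  assumes "is_partition \<mu>"
  shows "plen \<mu> \<le> N \<longleftrightarrow> (\<forall>i\<ge>N. \<mu> i = 0)"
  unfolding partition_eq_0_iff[OF assms] by auto

lemma fps_prod_nth_cong:
  fixes F G :: "'i \<Rightarrow> 'a::comm_ring_1 fps"
  assumes "\<And>i k. i \<in> I \<Longrightarrow> k \<le> m \<Longrightarrow> F i $ k = G i $ k" "n \<le> m"
  shows "(\<Prod>i\<in>I. F i) $ n = (\<Prod>i\<in>I. G i) $ n"
  using assms
proof (induction I arbitrary: n rule: infinite_finite_induct)
  case (insert a A)
  then show ?case by (auto simp: fps_mult_nth intro!: sum.cong)
qed auto

text \<open>
  Exponent vectors of degree \<open>m\<close> in \<open>N\<close> variables. The bound \<open>m\<close> on the entries, a consequence of the degree,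
  places them in a finite function space.
\<close>

definition exponents :: "nat \<Rightarrow> nat \<Rightarrow> (nat \<Rightarrow> nat) set" where
  "exponents N m = {\<beta> \<in> {..<N} \<rightarrow>\<^sub>E {..m}. (\<Sum>i<N. \<beta> i) = m}"

lemma finite_exponents: "finite (exponents N m)"
  unfolding exponents_def by (rule finite_subset[of _ "{..<N} \<rightarrow>\<^sub>E {..m}"]) (auto intro!: finite_PiE)

lemma prod_geometric_nth:
  fixes z :: "nat \<Rightarrow> 'a::comm_ring_1"
  shows "(\<Prod>i<N. Abs_fps (\<lambda>k. z i ^ k)) $ m = (\<Sum>\<beta>\<in>exponents N m. \<Prod>i<N. z i ^ \<beta> i)"
proof -
  \<comment> \<open>The coefficient at \<open>m\<close> only sees each factor up to degree \<open>m\<close>, so finite sums can be multiplied out.\<close>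
  have "(\<Prod>i<N. Abs_fps (\<lambda>k. z i ^ k)) $ m = (\<Prod>i<N. \<Sum>k\<le>m. fps_const (z i ^ k) * fps_X ^ k) $ m"
    by (rule fps_prod_nth_cong[where m = m]) (auto simp: fps_sum_nth fps_X_power_nth mult_delta_right)
  also have "\<dots> = (\<Sum>\<beta>\<in>{..<N} \<rightarrow>\<^sub>E {..m}. \<Prod>i<N. fps_const (z i ^ \<beta> i) * fps_X ^ \<beta> i) $ m"
    by (subst prod_sum_PiE) auto
  also have "\<dots> = (\<Sum>\<beta>\<in>{..<N} \<rightarrow>\<^sub>E {..m}. if (\<Sum>i<N. \<beta> i) = m then \<Prod>i<N. z i ^ \<beta> i else 0)"
  proof (subst fps_sum_nth, rule sum.cong[OF refl])
    fix \<beta> :: "nat \<Rightarrow> nat"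
    have "(\<Prod>i\<in>I. fps_const (z i ^ \<beta> i) * fps_X ^ \<beta> i)
        = fps_const (\<Prod>i\<in>I. z i ^ \<beta> i) * fps_X ^ (\<Sum>i\<in>I. \<beta> i)" if "finite I" for I
      using that
    proof (induction I rule: finite_induct)
      case (insert a A)
      then have "(\<Prod>i\<in>insert a A. fps_const (z i ^ \<beta> i) * fps_X ^ \<beta> i)
        = fps_const (z a ^ \<beta> a) * fps_X ^ \<beta> a * (fps_const (\<Prod>i\<in>A. z i ^ \<beta> i) * fps_X ^ (\<Sum>i\<in>A. \<beta> i))"
        by simp
      also have "\<dots> = (fps_const (z a ^ \<beta> a) * fps_const (\<Prod>i\<in>A. z i ^ \<beta> i))
          * (fps_X ^ \<beta> a * fps_X ^ (\<Sum>i\<in>A. \<beta> i))"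
        by (simp only: mult_ac)
      finally show ?case using insert by (simp add: power_add)
    qed simp
    then show "(\<Prod>i<N. fps_const (z i ^ \<beta> i) * fps_X ^ \<beta> i) $ m
      = (if (\<Sum>i<N. \<beta> i) = m then \<Prod>i<N. z i ^ \<beta> i else 0)"
      by (simp add: fps_X_power_nth)
  qed
  also have "\<dots> = (\<Sum>\<beta>\<in>exponents N m. \<Prod>i<N. z i ^ \<beta> i)"
    unfolding exponents_def by (subst sum.inter_filter) (auto intro!: finite_PiE)
  finally show ?thesis .
qed

text \<open>
  The position of \<open>\<beta> i\<close> when the entries of \<open>\<beta>\<close> are listed in decreasing order. Defining the
  permutation by counting makes its uniqueness immediate: it recovers \<open>\<tau>\<close> from a permuted strictly
  decreasing vector (\<open>sorting_perm_spread\<close>).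
\<close>

definition sorting_perm :: "nat \<Rightarrow> (nat \<Rightarrow> nat) \<Rightarrow> nat \<Rightarrow> nat" where
  "sorting_perm N \<beta> i = (if i < N then card {k. k < N \<and> \<beta> i < \<beta> k} else i)"

lemma sorting_perm_less:
  assumes "i < N" "k < N" "\<beta> k < \<beta> i"
  shows "sorting_perm N \<beta> i < sorting_perm N \<beta> k"
proof -
  have "card {j. j < N \<and> \<beta> i < \<beta> j} < card {j. j < N \<and> \<beta> k < \<beta> j}"
    using assms by (intro psubset_card_mono) auto
  then show ?thesis using assms by (simp add: sorting_perm_def)
qed

lemma sorting_perm_permutes:
  assumes "inj_on \<beta> {..<N}"
  shows "sorting_perm N \<beta> permutes {0..<N}"
proof (rule bij_imp_permutes)
  have maps: "sorting_perm N \<beta> ` {0..<N} \<subseteq> {0..<N}"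
  proof (rule image_subsetI)
    fix i assume i: "i \<in> {0..<N}"
    have "card {k. k < N \<and> \<beta> i < \<beta> k} \<le> card ({0..<N} - {i})"
      by (rule card_mono) auto
    also have "\<dots> < N" using i by simp
    finally show "sorting_perm N \<beta> i \<in> {0..<N}" using i by (simp add: sorting_perm_def)
  qed
  moreover have inj: "inj_on (sorting_perm N \<beta>) {0..<N}"
  proof (rule inj_onI)
    fix i k assume *: "i \<in> {0..<N}" "k \<in> {0..<N}" "sorting_perm N \<beta> i = sorting_perm N \<beta> k"
    then have "\<not> \<beta> k < \<beta> i" "\<not> \<beta> i < \<beta> k"
      using sorting_perm_less[of i N k \<beta>] sorting_perm_less[of k N i \<beta>] by auto
    then show "i = k" using * assms by (auto simp: inj_on_def)
  qed
  ultimately show "bij_betw (sorting_perm N \<beta>) {0..<N} {0..<N}"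
    by (simp add: bij_betw_def endo_inj_surj)
qed (auto simp: sorting_perm_def)

text \<open>
  The entries of \<open>\<nu> + \<delta>\<close>, permuted by \<open>\<tau>\<close>. The restriction places the vector among the extensional
  functions, where it is determined by its \<open>N\<close> entries.
\<close>

definition spread :: "nat \<Rightarrow> (nat \<Rightarrow> nat) \<Rightarrow> (nat \<Rightarrow> nat) \<Rightarrow> nat \<Rightarrow> nat" where
  "spread N \<nu> \<tau> = restrict (\<lambda>i. \<nu> (\<tau> i) + staircase N (\<tau> i)) {..<N}"

lemma shifted_partition_less_iff:
  assumes "is_partition \<nu>" "i < N" "j < N"
  shows "\<nu> j + staircase N j < \<nu> i + staircase N i \<longleftrightarrow> i < j"
  using partition_antimono[OF assms(1), of i j] partition_antimono[OF assms(1), of j i] assms(2,3)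
  by (cases i j rule: linorder_cases) (auto simp: staircase_def)

lemma sorting_perm_spread:
  assumes "is_partition \<nu>" "\<tau> permutes {0..<N}"
  shows "sorting_perm N (spread N \<nu> \<tau>) = \<tau>"
proof
  fix i
  show "sorting_perm N (spread N \<nu> \<tau>) i = \<tau> i"
  proof (cases "i < N")
    case True
    have lt: "\<tau> k < N \<longleftrightarrow> k < N" for k using permutes_in_image[OF assms(2), of k] by simp
    have "{k. k < N \<and> spread N \<nu> \<tau> i < spread N \<nu> \<tau> k} = {k. k < N \<and> \<tau> k < \<tau> i}"
      using True by (auto simp: spread_def shifted_partition_less_iff[OF assms(1)] lt)
    also have "\<dots> = \<tau> -` {..<\<tau> i}"
    proof -
      have "k < N" if "\<tau> k < \<tau> i" for k
      proof -
        have "\<tau> k < N" using that lt[of i] True by linarith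
        then show ?thesis using lt by blast
      qed
      then show ?thesis by auto
    qed
    also have "card \<dots> = \<tau> i"
      using permutes_inj[OF assms(2)] permutes_surj[OF assms(2)] by (subst card_vimage_inj) auto
    finally show ?thesis using True by (simp add: sorting_perm_def)
  next
    case False
    then show ?thesis using permutes_not_in[OF assms(2), of i] by (simp add: sorting_perm_def)
  qed
qed

lemma strictly_decreasing_ge_staircase:
  fixes \<alpha> :: "nat \<Rightarrow> nat"
  assumes dec: "\<And>i. Suc i < N \<Longrightarrow> \<alpha> (Suc i) < \<alpha> i" and "j < N"
  shows "staircase N j \<le> \<alpha> j"
proof -
  have "d < N \<Longrightarrow> d \<le> \<alpha> (N - 1 - d)" for d
  proof (induction d)
    case (Suc d)
    then have "Suc (N - 1 - Suc d) = N - 1 - d" by simp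
    then show ?case using Suc dec[of "N - 1 - Suc d"] by simp
  qed simp
  from this[of "N - 1 - j"] show ?thesis using assms(2) by (simp add: staircase_def)
qed

definition staircase_size :: "nat \<Rightarrow> nat" where
  "staircase_size N = (\<Sum>j<N. staircase N j)"

text \<open>
  An exponent vector with distinct entries is, in exactly one way, a permutation of a strictly
  decreasing one, and the strictly decreasing vectors of length \<open>N\<close> are the vectors \<open>\<nu> + \<delta>\<close> for
  partitions \<open>\<nu>\<close> with at most \<open>N\<close> parts.
\<close>

lemma bij_betw_spread:
  "bij_betw (\<lambda>(\<nu>, \<tau>). spread N \<nu> \<tau>)
     ({\<nu>. is_partition \<nu> \<and> plen \<nu> \<le> N \<and> psize \<nu> + staircase_size N = m} \<times> {\<tau>. \<tau> permutes {0..<N}})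
     {\<beta> \<in> exponents N m. inj_on \<beta> {..<N}}" (is "bij_betw ?S (?P \<times> ?T) ?B")
proof (rule bij_betw_imageI)
  show "inj_on ?S (?P \<times> ?T)"
  proof (rule inj_onI, clarify)
    fix \<nu> \<tau> \<nu>' \<tau>'
    assume \<nu>: "is_partition \<nu>" "plen \<nu> \<le> N" and \<tau>: "\<tau> permutes {0..<N}"
      and \<nu>': "is_partition \<nu>'" "plen \<nu>' \<le> N" and \<tau>': "\<tau>' permutes {0..<N}"
      and eq: "spread N \<nu> \<tau> = spread N \<nu>' \<tau>'"
    have "\<tau> = \<tau>'" using eq sorting_perm_spread[OF \<nu>(1) \<tau>] sorting_perm_spread[OF \<nu>'(1) \<tau>'] by simp
    moreover have "\<nu> j = \<nu>' j" for j
    proof (cases "j < N")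
      case True
      obtain i where i: "\<tau> i = j" using permutes_surj[OF \<tau>] by (metis surjD)
      then have "i < N" using True permutes_in_image[OF \<tau>, of i] by simp
      then show ?thesis using fun_cong[OF eq, of i] i \<open>\<tau> = \<tau>'\<close> by (simp add: spread_def)
    next
      case False
      then show ?thesis using \<nu> \<nu>' partition_eq_0_iff by (metis le_trans not_less)
    qed
    ultimately show "\<nu> = \<nu>' \<and> \<tau> = \<tau>'" by auto
  qed
  show "?S ` (?P \<times> ?T) = ?B"
  proof (intro equalityI subsetI)
    fix \<beta> assume "\<beta> \<in> ?S ` (?P \<times> ?T)"
    then obtain \<nu> \<tau> where \<nu>: "is_partition \<nu>" "plen \<nu> \<le> N" "psize \<nu> + staircase_size N = m"
      and \<tau>: "\<tau> permutes {0..<N}" and \<beta>: "\<beta> = spread N \<nu> \<tau>" by auto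
    have lt: "\<tau> k < N \<longleftrightarrow> k < N" for k using permutes_in_image[OF \<tau>, of k] by simp
    have "(\<Sum>i<N. \<beta> i) = (\<Sum>i\<in>{0..<N}. \<nu> (\<tau> i) + staircase N (\<tau> i))"
      unfolding \<beta> by (intro sum.cong) (auto simp: spread_def)
    also have "\<dots> = (\<Sum>i\<in>{0..<N}. \<nu> i + staircase N i)"
      using sum.permute[OF \<tau>, of "\<lambda>i. \<nu> i + staircase N i"] by (simp add: o_def)
    also have "\<dots> = m"
      using \<nu> psize_eq_sum[OF \<nu>(1,2)] by (simp add: sum.distrib staircase_size_def lessThan_atLeast0)
    finally have sum: "(\<Sum>i<N. \<beta> i) = m" .
    have "\<beta> i \<le> m" if "i < N" for i
      unfolding sum[symmetric] using that by (intro member_le_sum) auto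
    then have "\<beta> \<in> exponents N m" using sum by (auto simp: exponents_def \<beta> spread_def)
    moreover have "inj_on \<beta> {..<N}"
    proof (rule inj_onI)
      fix i k assume ik: "i \<in> {..<N}" "k \<in> {..<N}" "\<beta> i = \<beta> k"
      then have "\<not> \<tau> i < \<tau> k" "\<not> \<tau> k < \<tau> i"
        using shifted_partition_less_iff[OF \<nu>(1), of "\<tau> i" N "\<tau> k"]
          shifted_partition_less_iff[OF \<nu>(1), of "\<tau> k" N "\<tau> i"] lt
        by (auto simp: \<beta> spread_def)
      then show "i = k" using permutes_inj[OF \<tau>] by (auto dest: injD)
    qed
    ultimately show "\<beta> \<in> ?B" by simp
  next
    fix \<beta> assume "\<beta> \<in> ?B"
    then have sum: "(\<Sum>i<N. \<beta> i) = m" and ext: "\<beta> \<in> extensional {..<N}" and inj: "inj_on \<beta> {..<N}"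
      by (auto simp: exponents_def PiE_def)
    define \<tau> where "\<tau> = sorting_perm N \<beta>"
    define \<alpha> where "\<alpha> = (\<lambda>j. \<beta> (Hilbert_Choice.inv \<tau> j))"
    define \<nu> where "\<nu> = (\<lambda>j. if j < N then \<alpha> j - staircase N j else 0)"
    have \<tau>: "\<tau> permutes {0..<N}" unfolding \<tau>_def by (rule sorting_perm_permutes[OF inj])
    have lt: "\<tau> k < N \<longleftrightarrow> k < N" for k using permutes_in_image[OF \<tau>, of k] by simp
    have ilt: "Hilbert_Choice.inv \<tau> k < N \<longleftrightarrow> k < N" for k
      using permutes_in_image[OF permutes_inv[OF \<tau>], of k] by simp
    have \<alpha>_less: "\<alpha> j < \<alpha> i" if "i < j" "j < N" for i j
    proof (rule ccontr)
      assume "\<not> \<alpha> j < \<alpha> i"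
      moreover have "Hilbert_Choice.inv \<tau> i \<noteq> Hilbert_Choice.inv \<tau> j"
        using that permutes_inverses(1)[OF \<tau>] by (metis less_irrefl)
      then have "\<alpha> i \<noteq> \<alpha> j"
        using that ilt inj unfolding \<alpha>_def by (auto simp: inj_on_def)
      ultimately have "\<beta> (Hilbert_Choice.inv \<tau> i) < \<beta> (Hilbert_Choice.inv \<tau> j)" by (simp add: \<alpha>_def)
      then have "\<tau> (Hilbert_Choice.inv \<tau> j) < \<tau> (Hilbert_Choice.inv \<tau> i)"
        unfolding \<tau>_def using that ilt by (intro sorting_perm_less) (auto simp: \<tau>_def)
      then show False using that permutes_inverses(1)[OF \<tau>] by simp
    qed
    have ge: "staircase N j \<le> \<alpha> j" if "j < N" for j
      using that by (intro strictly_decreasing_ge_staircase \<alpha>_less) auto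
    have "\<nu> (Suc j) \<le> \<nu> j" for j
      using \<alpha>_less[of j "Suc j"] ge[of "Suc j"] by (auto simp: \<nu>_def staircase_def)
    then have part: "is_partition \<nu>"
      unfolding is_partition_def by (auto simp: decseq_Suc_iff \<nu>_def)
    have len: "plen \<nu> \<le> N" unfolding plen_le_iff[OF part] by (simp add: \<nu>_def)
    have \<beta>: "spread N \<nu> \<tau> = \<beta>"
    proof
      fix i
      show "spread N \<nu> \<tau> i = \<beta> i"
        using ge[of "\<tau> i"] lt[of i] permutes_inverses(2)[OF \<tau>] ext
        by (auto simp: spread_def \<nu>_def \<alpha>_def extensional_def)
    qed
    have "m = (\<Sum>i\<in>{0..<N}. \<nu> (\<tau> i) + staircase N (\<tau> i))"
      unfolding sum[symmetric] \<beta>[symmetric] by (intro sum.cong) (auto simp: spread_def)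
    also have "\<dots> = (\<Sum>i\<in>{0..<N}. \<nu> i + staircase N i)"
      using sum.permute[OF \<tau>, of "\<lambda>i. \<nu> i + staircase N i"] by (simp add: o_def)
    also have "\<dots> = psize \<nu> + staircase_size N"
      using psize_eq_sum[OF part len] by (simp add: sum.distrib staircase_size_def lessThan_atLeast0)
    finally show "\<beta> \<in> ?S ` (?P \<times> ?T)"
      using part len \<tau> \<beta> by (intro image_eqI[of _ _ "(\<nu>, \<tau>)"]) auto
  qed
qed

section \<open>The Cauchy identity\<close>

lemma det_power_rows_spread:
  fixes y :: "nat \<Rightarrow> 'a::comm_ring_1"
  assumes "\<tau> permutes {0..<N}"
  shows "det (mat N N (\<lambda>(i, j). y j ^ spread N \<nu> \<tau> i))
       = signof \<tau> * alternant N (\<lambda>j. \<nu> j + staircase N j) y"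
proof -
  let ?A = "mat N N (\<lambda>(i, j). y j ^ (\<nu> i + staircase N i))"
  have lt: "\<tau> k < N \<longleftrightarrow> k < N" for k using permutes_in_image[OF assms, of k] by simp
  have "det (mat N N (\<lambda>(i, j). y j ^ spread N \<nu> \<tau> i)) = det (mat N N (\<lambda>(i, j). ?A $$ (\<tau> i, j)))"
    by (rule det_mat_cong) (simp add: spread_def lt)
  also have "\<dots> = signof \<tau> * det ?A" by (rule det_permute_rows[OF _ assms]) simp
  also have "det ?A = alternant N (\<lambda>j. \<nu> j + staircase N j) y"
    unfolding alternant_def by (rule det_transpose_mat)
  finally show ?thesis .
qed

text \<open>
  The Cauchy-Binet formula for the factorization of \<open>1 / (1 - Q x_i y_j)\<close> into the infinite matrices
  \<open>x_i ^ k\<close> and \<open>Q ^ k y_j ^ k\<close>, read off at the coefficient of \<open>Q ^ m\<close>. Expanding the determinant row by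
  row gives a sum over exponent vectors; those with a repeated entry give equal rows, and the others
  are grouped by \<open>bij_betw_spread\<close>.
\<close>

lemma cauchy_binet_geometric:
  fixes x y :: "nat \<Rightarrow> 'a::comm_ring_1"
  shows "det (mat N N (\<lambda>(i, j). Abs_fps (\<lambda>k. (x i * y j) ^ k))) $ m
    = (\<Sum>\<nu> | is_partition \<nu> \<and> plen \<nu> \<le> N \<and> psize \<nu> + staircase_size N = m.
         alternant N (\<lambda>j. \<nu> j + staircase N j) x * alternant N (\<lambda>j. \<nu> j + staircase N j) y)"
proof -
  let ?P = "{\<nu>. is_partition \<nu> \<and> plen \<nu> \<le> N \<and> psize \<nu> + staircase_size N = m}"
  let ?T = "{\<tau>. \<tau> permutes {0..<N}}"
  let ?D = "\<lambda>\<beta>. det (mat N N (\<lambda>(i, j). y j ^ \<beta> i))"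
  have "det (mat N N (\<lambda>(i, j). Abs_fps (\<lambda>k. (x i * y j) ^ k))) $ m
      = (\<Sum>p\<in>?T. signof p * (\<Prod>i<N. Abs_fps (\<lambda>k. (x i * y (p i)) ^ k)) $ m)"
    unfolding det_mat_eq fps_sum_nth
    by (intro sum.cong refl) (auto simp: sign_def lessThan_atLeast0)
  also have "\<dots> = (\<Sum>p\<in>?T. \<Sum>\<beta>\<in>exponents N m. (\<Prod>i<N. x i ^ \<beta> i) * (signof p * (\<Prod>i<N. y (p i) ^ \<beta> i)))"
    unfolding prod_geometric_nth by (simp add: sum_distrib_left power_mult_distrib prod.distrib mult_ac)
  also have "\<dots> = (\<Sum>\<beta>\<in>exponents N m. (\<Prod>i<N. x i ^ \<beta> i) * ?D \<beta>)"
    by (subst sum.swap) (simp add: det_mat_eq sum_distrib_left lessThan_atLeast0)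
  also have "\<dots> = (\<Sum>\<beta>\<in>{\<beta> \<in> exponents N m. inj_on \<beta> {..<N}}. (\<Prod>i<N. x i ^ \<beta> i) * ?D \<beta>)"
  proof (rule sum.mono_neutral_right)
    show "\<forall>\<beta>\<in>exponents N m - {\<beta> \<in> exponents N m. inj_on \<beta> {..<N}}. (\<Prod>i<N. x i ^ \<beta> i) * ?D \<beta> = 0"
    proof
      fix \<beta> assume "\<beta> \<in> exponents N m - {\<beta> \<in> exponents N m. inj_on \<beta> {..<N}}"
      then obtain i k where ik: "i < N" "k < N" "i \<noteq> k" "\<beta> i = \<beta> k" by (auto simp: inj_on_def)
      have "?D \<beta> = 0"
        by (rule det_identical_rows[OF _ ik(3,1,2)]) (use ik in auto)
      then show "(\<Prod>i<N. x i ^ \<beta> i) * ?D \<beta> = 0" by simp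
    qed
  qed (auto simp: finite_exponents)
  also have "\<dots> = (\<Sum>(\<nu>, \<tau>)\<in>?P \<times> ?T. (\<Prod>i<N. x i ^ spread N \<nu> \<tau> i) * ?D (spread N \<nu> \<tau>))"
    by (subst sum.reindex_bij_betw[OF bij_betw_spread, symmetric]) (simp add: case_prod_unfold)
  also have "\<dots> = (\<Sum>\<nu>\<in>?P. \<Sum>\<tau>\<in>?T. (\<Prod>i<N. x i ^ spread N \<nu> \<tau> i) * ?D (spread N \<nu> \<tau>))"
    by (rule sum.cartesian_product[symmetric])
  also have "\<dots> = (\<Sum>\<nu>\<in>?P. alternant N (\<lambda>j. \<nu> j + staircase N j) x
                          * alternant N (\<lambda>j. \<nu> j + staircase N j) y)"
  proof (intro sum.cong refl)
    fix \<nu>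
    let ?\<alpha> = "\<lambda>j. \<nu> j + staircase N j"
    have "(\<Sum>\<tau>\<in>?T. (\<Prod>i<N. x i ^ spread N \<nu> \<tau> i) * ?D (spread N \<nu> \<tau>))
        = (\<Sum>\<tau>\<in>?T. signof \<tau> * (\<Prod>i=0..<N. x i ^ ?\<alpha> (\<tau> i)) * alternant N ?\<alpha> y)"
      by (intro sum.cong refl)
        (simp add: det_power_rows_spread mult_ac, simp add: spread_def lessThan_atLeast0 mult_ac)
    then show "(\<Sum>\<tau>\<in>?T. (\<Prod>i<N. x i ^ spread N \<nu> \<tau> i) * ?D (spread N \<nu> \<tau>))
        = alternant N ?\<alpha> x * alternant N ?\<alpha> y"
      by (simp add: alternant_def[of N ?\<alpha> x] det_mat_eq sum_distrib_right)
  qed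
  finally show ?thesis .
qed

lemma alternant_fps_const:
  "alternant N \<alpha> (\<lambda>i. fps_const (x i)) = fps_const (alternant N \<alpha> x)"
proof -
  have prod: "fps_const (\<Prod>i\<in>I. g i) = (\<Prod>i\<in>I. fps_const (g i))" for g :: "nat \<Rightarrow> 'a" and I
    by (induction I rule: infinite_finite_induct) (auto simp flip: fps_const_mult)
  have sum: "fps_const (\<Sum>p\<in>T. g p) = (\<Sum>p\<in>T. fps_const (g p))" for g :: "(nat \<Rightarrow> nat) \<Rightarrow> 'a" and T
    by (induction T rule: infinite_finite_induct) (auto simp flip: fps_const_add)
  have sgn: "fps_const (signof p * c) = signof p * fps_const c" for p :: "nat \<Rightarrow> nat" and c :: 'a
    by (simp add: sign_def)
  show ?thesis
    unfolding alternant_def det_mat_eq sum sgn prod by (simp add: fps_const_power)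
qed

lemma alternant_fps_X:
  "alternant N \<alpha> (\<lambda>i. fps_const (x i) * fps_X) = fps_X ^ (\<Sum>j<N. \<alpha> j) * fps_const (alternant N \<alpha> x)"
proof -
  have "alternant N \<alpha> (\<lambda>i. fps_const (x i) * fps_X)
      = det (mat N N (\<lambda>(i, j). 1 * fps_X ^ \<alpha> j * fps_const (x i) ^ \<alpha> j))"
    unfolding alternant_def by (rule det_mat_cong) (simp add: power_mult_distrib mult_ac)
  also have "\<dots> = fps_X ^ (\<Sum>j<N. \<alpha> j) * alternant N \<alpha> (\<lambda>i. fps_const (x i))"
    unfolding det_scale alternant_def by (simp add: power_sum)
  finally show ?thesis by (simp only: alternant_fps_const)
qed

text \<open>
  The indeterminate is attached to \<open>y\<close>, so \<open>cauchy_determinant\<close> in the ring of power series produces the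
  factor \<open>X ^ staircase_size N\<close>, which accounts for the shift of degrees from \<open>\<nu>\<close> to \<open>\<nu> + \<delta>\<close>.
\<close>

lemma cauchy_identity_alternants:
  fixes x y :: "nat \<Rightarrow> 'a::comm_ring_1"
  shows "vandermonde N x * vandermonde N y * (\<Prod>i<N. \<Prod>j<N. Abs_fps (\<lambda>k. (x i * y j) ^ k)) $ n
    = (\<Sum>\<nu> | is_partition \<nu> \<and> plen \<nu> \<le> N \<and> psize \<nu> = n.
         alternant N (\<lambda>j. \<nu> j + staircase N j) x * alternant N (\<lambda>j. \<nu> j + staircase N j) y)"
proof -
  let ?G = "\<lambda>i j. Abs_fps (\<lambda>k. (x i * y j) ^ k)"
  have "det (mat N N (\<lambda>(i, j). ?G i j)) = vandermonde N (\<lambda>i. fps_const (x i))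
      * vandermonde N (\<lambda>j. fps_const (y j) * fps_X) * (\<Prod>i<N. \<Prod>j<N. ?G i j)"
  proof (rule cauchy_determinant)
    fix i j
    have "fps_const (x i) * (fps_const (y j) * fps_X) = fps_const (x i * y j) * fps_X"
      by (simp add: mult.assoc[symmetric])
    then show "(1 - fps_const (x i) * (fps_const (y j) * fps_X)) * ?G i j = 1"
      by (simp only: geometric_series_inverse)
  qed
  also have "\<dots> = fps_X ^ staircase_size N * (fps_const (vandermonde N x * vandermonde N y)
      * (\<Prod>i<N. \<Prod>j<N. ?G i j))"
    unfolding alternant_fps_const alternant_fps_X staircase_size_def fps_const_mult[symmetric]
    by (simp only: mult_ac)
  finally have "det (mat N N (\<lambda>(i, j). ?G i j)) $ (n + staircase_size N)
      = vandermonde N x * vandermonde N y * (\<Prod>i<N. \<Prod>j<N. ?G i j) $ n"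
    by (simp add: fps_X_power_mult_nth)
  then show ?thesis by (simp add: cauchy_binet_geometric)
qed

lemma schur_poly_eq_alternants:
  assumes "plen \<nu> \<le> N"
  shows "schur_poly N \<nu> x = alternant N (\<lambda>j. \<nu> j + staircase N j) x / vandermonde N x"
  using assms by (simp add: schur_poly_def alternant_def staircase_def)

theorem cauchy_identity:
  fixes x y :: "nat \<Rightarrow> 'a::field"
  assumes "vandermonde N x \<noteq> 0" "vandermonde N y \<noteq> 0"
  shows "(\<Sum>\<nu> | is_partition \<nu> \<and> plen \<nu> \<le> N \<and> psize \<nu> = n. schur_poly N \<nu> x * schur_poly N \<nu> y)
       = (\<Prod>i<N. \<Prod>j<N. Abs_fps (\<lambda>k. (x i * y j) ^ k)) $ n"
proof -
  have "(\<Sum>\<nu> | is_partition \<nu> \<and> plen \<nu> \<le> N \<and> psize \<nu> = n. schur_poly N \<nu> x * schur_poly N \<nu> y)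
      = (\<Sum>\<nu> | is_partition \<nu> \<and> plen \<nu> \<le> N \<and> psize \<nu> = n.
         alternant N (\<lambda>j. \<nu> j + staircase N j) x * alternant N (\<lambda>j. \<nu> j + staircase N j) y)
        / (vandermonde N x * vandermonde N y)"
    unfolding sum_divide_distrib by (intro sum.cong refl) (simp add: schur_poly_eq_alternants)
  then show ?thesis using assms unfolding cauchy_identity_alternants[symmetric] by simp
qed

section \<open>Powers of the square root of q\<close>

lemma qhalf_neq_0 [simp]: "qhalf \<noteq> 0"
  by (simp add: qhalf_def)

lemma q_neq_0 [simp]: "q \<noteq> 0"
  by (simp add: q_def)

lemma qhalf_powi: "qhalf powi m = fls_X_intpow (- m)"
proof -
  have inv: "qhalf = inverse fls_X" by (simp add: qhalf_def fls_inverse_X)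
  have "qhalf powi m = inverse (fls_X powi m)" by (simp only: inv power_int_inverse)
  also have "\<dots> = fls_X powi (- m)" by (rule power_int_minus[symmetric])
  finally show ?thesis by simp
qed

lemma fls_nth_qhalf_powi: "fls_nth (qhalf powi m) k = (if k = - m then 1 else 0)"
  by (simp add: qhalf_powi)

lemma qhalf_powi_inj: "qhalf powi m = qhalf powi n \<longleftrightarrow> m = n"
  by (metis fls_nth_qhalf_powi neg_equal_iff_equal zero_neq_one)

lemma q_powi: "q powi m = qhalf powi (2 * m)"
  by (simp add: q_def power_int_mult)

lemma qhalf_powi_tendsto_0:
  assumes "filterlim e at_bot F"
  shows "((\<lambda>x. qhalf powi e x) \<longlongrightarrow> 0) F"
  unfolding fls_tendsto_iff
proof
  fix k :: int
  have "eventually (\<lambda>x. e x \<le> - k) F" using assms by (simp add: filterlim_at_bot)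
  then show "eventually (\<lambda>x. \<forall>i<k. fls_nth (qhalf powi e x - 0) i = 0) F"
    by eventually_elim (simp add: fls_nth_qhalf_powi)
qed

section \<open>Symmetry of the Schur polynomial pairing\<close>

text \<open>
  The alternant at \<open>q^(\<mu>+\<rho>)\<close> with exponents \<open>\<nu> + \<delta>\<close>, with the powers of \<open>q\<close> removed that belong to a
  single row or column (\<open>alternant_q_shift\<close>). In this form the symmetry in \<open>\<mu>\<close> and \<open>\<nu>\<close> is the invariance of
  the determinant under transposition.
\<close>

definition q_pairing :: "nat \<Rightarrow> (nat \<Rightarrow> nat) \<Rightarrow> (nat \<Rightarrow> nat) \<Rightarrow> rat fls" where
  "q_pairing N \<mu> \<nu> = det (mat N N (\<lambda>(i, j). q powi ((int (\<mu> i) - int i) * (int (\<nu> j) - int j))))"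

lemma q_pairing_sym: "q_pairing N \<mu> \<nu> = q_pairing N \<nu> \<mu>"
  unfolding q_pairing_def by (subst det_transpose_mat) (simp add: mult.commute)

text \<open>
  The matrix of values of the monic polynomials \<open>\<Prod>l<k. (t - z l)\<close> at the points \<open>z i\<close> is lower
  triangular, and it differs from the matrix of powers by a unitriangular factor.
\<close>

lemma vandermonde_increasing:
  fixes z :: "nat \<Rightarrow> 'a::comm_ring_1"
  shows "det (mat N N (\<lambda>(i, j). z i ^ j)) = (\<Prod>j<N. \<Prod>i<j. z j - z i)"
proof -
  \<comment> \<open>The Newton basis of the polynomials.\<close>
  define p where "p k = (\<Prod>l<k. [:- z l, 1:])" for k
  have deg: "degree (p k) \<le> k" for k
  proof -
    have "degree (p k) \<le> (\<Sum>l<k. degree [:- z l, 1:])"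
      unfolding p_def by (intro degree_prod_sum_le[unfolded o_def]) auto
    also have "\<dots> \<le> (\<Sum>l<k. 1)" by (intro sum_mono) auto
    finally show ?thesis by simp
  qed
  have monic: "coeff (p k) k = 1" for k
  proof (induction k)
    case (Suc k)
    have "p (Suc k) = pCons 0 (p k) - Polynomial.smult (z k) (p k)" by (simp add: p_def)
    then show ?case using Suc deg[of k] by (simp add: coeff_eq_0)
  qed (simp add: p_def)
  have "det (mat N N (\<lambda>(i, k). \<Prod>l<k. z i - z l)) = det (mat N N (\<lambda>(i, k). \<Sum>m<N. z i ^ m * coeff (p k) m))"
  proof (rule det_mat_cong, unfold prod.case)
    fix i k assume "i < N" "k < N"
    have "(\<Prod>l<k. z i - z l) = poly (p k) (z i)" by (simp add: p_def poly_prod)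
    also have "\<dots> = (\<Sum>m\<le>degree (p k). z i ^ m * coeff (p k) m)" by (simp add: poly_altdef mult.commute)
    also have "\<dots> = (\<Sum>m<N. z i ^ m * coeff (p k) m)"
      using deg[of k] \<open>k < N\<close> by (intro sum.mono_neutral_left) (auto simp: coeff_eq_0)
    finally show "(\<Prod>l<k. z i - z l) = (\<Sum>m<N. z i ^ m * coeff (p k) m)" .
  qed
  also have "\<dots> = det (mat N N (\<lambda>(i, j). z i ^ j)) * det (mat N N (\<lambda>(m, k). coeff (p k) m))"
    by (rule det_product)
  also have "det (mat N N (\<lambda>(m, k). coeff (p k) m)) = 1"
  proof -
    have "coeff (p k) m = 0" if "k < m" for k m
      using deg[of k] that by (intro coeff_eq_0) simp
    then have "upper_triangular (mat N N (\<lambda>(m, k). coeff (p k) m))" by auto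
    then show ?thesis
      by (subst det_upper_triangular[of _ N]) (auto simp: prod_list_diag_prod monic)
  qed
  finally have "det (mat N N (\<lambda>(i, j). z i ^ j)) = det (mat N N (\<lambda>(i, k). \<Prod>l<k. z i - z l))" by simp
  also have "\<dots> = (\<Prod>j<N. \<Prod>i<j. z j - z i)"
  proof -
    have "(\<Prod>l<k. z i - z l) = 0" if "i < k" for i k
      using that by (intro prod_zero) auto
    then show ?thesis
      by (subst det_lower_triangular[of N]) (auto simp: prod_list_diag_prod lessThan_atLeast0)
  qed
  finally show ?thesis .
qed

lemma q_pairing_empty:
  "q_pairing N \<mu> (\<lambda>_. 0) = (\<Prod>j<N. \<Prod>i<j. q powi (int j - int (\<mu> j)) - q powi (int i - int (\<mu> i)))"
proof -
  have "q powi ((int (\<mu> i) - int i) * (int 0 - int j)) = (q powi (int i - int (\<mu> i))) ^ j" for i j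
  proof -
    have "(int (\<mu> i) - int i) * (int 0 - int j) = (int i - int (\<mu> i)) * int j" by (simp add: algebra_simps)
    then show ?thesis by (simp only: power_int_mult power_int_of_nat)
  qed
  then show ?thesis unfolding q_pairing_def vandermonde_increasing[symmetric] by (simp only:)
qed

lemma q_pairing_empty_nonzero:
  assumes "is_partition \<mu>"
  shows "q_pairing N \<mu> (\<lambda>_. 0) \<noteq> 0"
proof -
  have "q powi (int j - int (\<mu> j)) \<noteq> q powi (int i - int (\<mu> i))" if "i < j" for i j
    using partition_antimono[OF assms, of i j] that by (simp add: q_powi qhalf_powi_inj)
  then show ?thesis unfolding q_pairing_empty by simp
qed

text \<open>
  With \<open>a = \<mu> i - i\<close> and \<open>b = \<nu> j - j\<close>, the entry is \<open>qhalf\<close> to the power \<open>(2 * a - 1) * (b + N - 1)\<close>. This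
  exponent splits into a part belonging to the row, the part \<open>- b\<close> belonging to the column, and
  \<open>2 * a * b\<close>.
\<close>

lemma alternant_q_shift:
  "alternant N (\<lambda>j. \<nu> j + staircase N j) (q_shift \<mu>)
     = (\<Prod>i<N. qhalf powi ((2 * (int (\<mu> i) - int i) - 1) * (int N - 1)))
       * (\<Prod>j<N. qhalf powi (int j - int (\<nu> j))) * q_pairing N \<mu> \<nu>"
  unfolding alternant_def q_pairing_def det_scale[symmetric]
proof (rule det_mat_cong, unfold prod.case)
  fix i j assume ij: "i < N" "j < N"
  let ?a = "int (\<mu> i) - int i" and ?b = "int (\<nu> j) - int j"
  have st: "int (\<nu> j + staircase N j) = ?b + (int N - 1)"
    using ij by (simp add: staircase_def of_nat_diff)
  have "q_shift \<mu> i ^ (\<nu> j + staircase N j) = qhalf powi ((2 * ?a - 1) * int (\<nu> j + staircase N j))"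
    by (simp only: q_shift_def power_int_mult power_int_of_nat)
  also have "(2 * ?a - 1) * int (\<nu> j + staircase N j)
      = (2 * ?a - 1) * (int N - 1) + (int j - int (\<nu> j)) + 2 * (?a * ?b)"
    unfolding st by (simp add: algebra_simps)
  also have "qhalf powi \<dots> = qhalf powi ((2 * ?a - 1) * (int N - 1)) * qhalf powi (int j - int (\<nu> j)) * q powi (?a * ?b)"
    by (simp only: q_powi power_int_add[OF disjI1[OF qhalf_neq_0]])
  finally show "q_shift \<mu> i ^ (\<nu> j + staircase N j)
    = qhalf powi ((2 * ?a - 1) * (int N - 1)) * qhalf powi (int j - int (\<nu> j)) * q powi (?a * ?b)" .
qed

lemma vandermonde_q_shift_nonzero:
  assumes "is_partition \<mu>"
  shows "vandermonde N (q_shift \<mu>) \<noteq> 0"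
proof -
  have "(\<lambda>j. 0 + staircase N j) = staircase N" by simp
  then show ?thesis
    using alternant_q_shift[of N "\<lambda>_. 0" \<mu>] q_pairing_empty_nonzero[OF assms, of N]
    by (simp add: power_int_eq_0_iff)
qed

lemma prod_powi:
  assumes "(b::'a::field) \<noteq> 0"
  shows "(\<Prod>i\<in>I. b powi e i) = b powi (\<Sum>i\<in>I. e i)"
  using assms by (induction I rule: infinite_finite_induct) (auto simp: power_int_add)

lemma schur_poly_q_shift:
  assumes "is_partition \<mu>" "is_partition \<nu>" "plen \<nu> \<le> N"
  shows "schur_poly N \<nu> (q_shift \<mu>)
       = qhalf powi (- int (psize \<nu>)) * q_pairing N \<mu> \<nu> / q_pairing N \<mu> (\<lambda>_. 0)"
proof -
  have st: "staircase N = (\<lambda>j. (\<lambda>_. 0) j + staircase N j)" by simp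
  have "(\<Prod>j<N. qhalf powi (int j - int (\<nu> j))) = qhalf powi (- int (psize \<nu>)) * (\<Prod>j<N. qhalf powi (int j - int 0))"
  proof -
    have "(\<Sum>j<N. int j - int (\<nu> j)) = - int (psize \<nu>) + (\<Sum>j<N. int j - int 0)"
      using psize_eq_sum[OF assms(2,3)] by (simp add: sum_subtractf)
    then show ?thesis by (simp only: prod_powi[OF qhalf_neq_0] power_int_add[OF disjI1[OF qhalf_neq_0]])
  qed
  moreover have "(\<Prod>j<N. qhalf powi (int j - int 0)) \<noteq> 0"
    "(\<Prod>i<N. qhalf powi ((2 * (int (\<mu> i) - int i) - 1) * (int N - 1))) \<noteq> 0"
    by (simp_all add: power_int_eq_0_iff)
  moreover have "vandermonde N (q_shift \<mu>) = (\<Prod>i<N. qhalf powi ((2 * (int (\<mu> i) - int i) - 1) * (int N - 1)))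
       * (\<Prod>j<N. qhalf powi (int j - int 0)) * q_pairing N \<mu> (\<lambda>_. 0)"
    by (subst st, subst alternant_q_shift) simp
  ultimately show ?thesis
    unfolding schur_poly_eq_alternants[OF assms(3)] alternant_q_shift by simp
qed

text \<open>
  Both sides equal \<open>q_pairing N \<mu> \<nu> / q_pairing N 0 0\<close> up to the same power of \<open>qhalf\<close>.
\<close>

lemma schur_poly_symmetry:
  assumes "is_partition \<mu>" "is_partition \<nu>" "plen \<mu> \<le> N" "plen \<nu> \<le> N"
  shows "schur_poly N \<mu> (q_shift empty_part) * schur_poly N \<nu> (q_shift \<mu>)
       = schur_poly N \<nu> (q_shift empty_part) * schur_poly N \<mu> (q_shift \<nu>)"
  unfolding schur_poly_q_shift[OF is_partition_empty assms(1,3)] schur_poly_q_shift[OF is_partition_empty assms(2,4)]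
    schur_poly_q_shift[OF assms(1,2,4)] schur_poly_q_shift[OF assms(2,1,3)]
    q_pairing_sym[of N "\<lambda>_. 0" \<mu>] q_pairing_sym[of N "\<lambda>_. 0" \<nu>] q_pairing_sym[of N \<nu> \<mu>]
  using q_pairing_empty_nonzero[OF assms(1), of N] q_pairing_empty_nonzero[OF assms(2), of N]
  by (simp add: mult_ac)

section \<open>Schur functions at shifted staircase points\<close>

definition shifted_sum :: "(nat \<Rightarrow> nat) \<Rightarrow> rat fls \<Rightarrow> rat fls" where
  "shifted_sum \<mu> y = (\<Sum>i. y powi (int (\<mu> i) - int (i + 1)))"

text \<open>
  The difference between \<open>shifted_sum \<mu> y\<close> and \<open>shifted_sum empty_part y\<close>, a finite sum.
\<close>

definition shifted_sum_excess :: "(nat \<Rightarrow> nat) \<Rightarrow> rat fls \<Rightarrow> rat fls" where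
  "shifted_sum_excess \<mu> y = (\<Sum>i<plen \<mu>. y powi (int (\<mu> i) - int (i + 1)) - y powi (- int (i + 1)))"

lemma q_power_neq_1: "n \<ge> 1 \<Longrightarrow> q ^ n \<noteq> 1"
  using qhalf_powi_inj[of "2 * int n" 0] q_powi[of "int n"] by (simp add: power_int_of_nat)

lemma shifted_sums_empty:
  assumes "n \<ge> 1" "y = q ^ n"
  shows "(\<lambda>i. y powi (- int (i + 1))) sums (1 / (y - 1))"
  unfolding sums_def
proof -
  have y: "y \<noteq> 1" "y \<noteq> 0" using q_power_neq_1[OF assms(1)] by (auto simp: assms)
  have partial: "(\<Sum>i<N. y powi (- int (i + 1))) = (1 - qhalf powi (- 2 * int n * int N)) * (1 / (y - 1))" for N
  proof -
    have "qhalf powi (- 2 * int n * int N) = y powi (- int N)"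
      by (simp add: assms power_int_minus q_def power_int_mult power_int_of_nat flip: power_mult of_nat_mult)
    moreover have "(\<Sum>i<N. y powi (- int (i + 1))) * (y - 1) = 1 - y powi (- int N)"
    proof (induction N)
      case (Suc N)
      have "y powi (- int N) = y * y powi (- int (Suc N))"
        using y power_int_add_1'[of y "- int (Suc N)"] by simp
      then show ?case using Suc by (simp add: algebra_simps)
    qed simp
    ultimately show ?thesis using y by (simp add: field_simps)
  qed
  have "filterlim (\<lambda>N. - 2 * int n * int N) at_bot sequentially"
    unfolding filterlim_at_bot eventually_sequentially
  proof
    fix Z :: int
    have "- 2 * int n * int N \<le> Z" if "nat (- Z) \<le> N" for N
    proof -
      have "int N \<le> 2 * int n * int N" using assms(1) mult_right_mono[of 1 "2 * int n" "int N"] by simp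
      then show ?thesis using that by simp
    qed
    then show "\<exists>M. \<forall>N\<ge>M. - 2 * int n * int N \<le> Z" by blast
  qed
  then have "(\<lambda>N. qhalf powi (- 2 * int n * int N)) \<longlonglongrightarrow> 0" by (rule qhalf_powi_tendsto_0)
  then have "(\<lambda>N. (1 + (-1) * qhalf powi (- 2 * int n * int N)) * (1 / (y - 1))) \<longlonglongrightarrow> (1 + (-1) * 0) * (1 / (y - 1))"
    by (intro tendsto_mult tendsto_add tendsto_const)
  then show "(\<lambda>N. \<Sum>i<N. y powi (- int (i + 1))) \<longlonglongrightarrow> 1 / (y - 1)" unfolding partial by simp
qed

lemma shifted_sums:
  assumes "is_partition \<mu>" "n \<ge> 1" "y = q ^ n"
  shows "(\<lambda>i. y powi (int (\<mu> i) - int (i + 1))) sums (shifted_sum_excess \<mu> y + 1 / (y - 1))"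
proof -
  have "(\<lambda>i. y powi (int (\<mu> i) - int (i + 1)) - y powi (- int (i + 1))) sums shifted_sum_excess \<mu> y"
    unfolding shifted_sum_excess_def
  proof (rule sums_finite)
    fix i assume "i \<notin> {..<plen \<mu>}"
    then have "\<mu> i = 0" using partition_eq_0_iff[OF assms(1), of i] by simp
    then show "y powi (int (\<mu> i) - int (i + 1)) - y powi (- int (i + 1)) = 0" by simp
  qed simp
  from sums_add[OF this shifted_sums_empty[OF assms(2,3)]] show ?thesis by simp
qed

lemma shifted_sum_eq:
  assumes "is_partition \<mu>" "n \<ge> 1"
  shows "shifted_sum \<mu> (q ^ n) = shifted_sum_excess \<mu> (q ^ n) + 1 / (q ^ n - 1)"
  unfolding shifted_sum_def using shifted_sums[OF assms refl] by (rule sums_unique[symmetric])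

lemma power_sum_q_shift_tendsto:
  assumes "is_partition \<mu>" "n \<ge> 1"
  shows "(\<lambda>N. \<Sum>i<N. q_shift \<mu> i ^ n) \<longlonglongrightarrow> qhalf ^ n * shifted_sum \<mu> (q ^ n)"
proof -
  have "q_shift \<mu> i ^ n = qhalf ^ n * (q ^ n) powi (int (\<mu> i) - int (i + 1))" for i
  proof -
    let ?e = "int (\<mu> i) - int (i + 1)"
    have "q_shift \<mu> i ^ n = (qhalf powi (1 + 2 * ?e)) ^ n"
      by (simp add: q_shift_def algebra_simps)
    also have "qhalf powi (1 + 2 * ?e) = qhalf * q powi ?e"
      by (simp only: q_powi power_int_add[OF disjI1[OF qhalf_neq_0]] power_int_1_right)
    also have "(qhalf * q powi ?e) ^ n = qhalf ^ n * (q ^ n) powi ?e"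
      by (simp add: power_mult_distrib power_int_power power_int_power' mult.commute)
    finally show ?thesis .
  qed
  moreover have "(\<lambda>N. \<Sum>i<N. (q ^ n) powi (int (\<mu> i) - int (i + 1))) \<longlonglongrightarrow> shifted_sum \<mu> (q ^ n)"
    using shifted_sums[OF assms refl] unfolding sums_def shifted_sum_eq[OF assms] .
  ultimately show ?thesis by (simp add: sum_distrib_left[symmetric] tendsto_mult_left)
qed

lemma complete_fps_eq_plexp:
  fixes x :: "nat \<Rightarrow> 'a::field_char_0"
  shows "complete_fps N x = plexp (\<lambda>k. \<Sum>l<N. x l ^ k)"
  by (simp add: complete_fps_def plexp_sum plexp_power)

text \<open>
  The size \<open>l\<close> stays fixed, so the determinant is a fixed polynomial in finitely many coefficients.
\<close>

lemma jacobi_trudi_tendsto: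
  fixes H :: "nat \<Rightarrow> rat fls fps"
  assumes "\<And>n. (\<lambda>N. H N $ n) \<longlonglongrightarrow> L $ n"
  shows "(\<lambda>N. jacobi_trudi l \<nu> (H N)) \<longlonglongrightarrow> jacobi_trudi l \<nu> L"
proof -
  have "(\<lambda>N. fps_nth_int (H N) m) \<longlonglongrightarrow> fps_nth_int L m" for m
    using assms by (simp add: fps_nth_int_def)
  then show ?thesis
    unfolding jacobi_trudi_def det_mat_eq prod.case
    by (intro tendsto_sum tendsto_mult tendsto_const tendsto_prod')
qed

lemma schur_poly_eq_jacobi_trudi:
  assumes "is_partition \<mu>" "is_partition \<nu>" "plen \<nu> \<le> N"
  shows "schur_poly N \<nu> (q_shift \<mu>) = jacobi_trudi (plen \<nu>) \<nu> (complete_fps N (q_shift \<mu>))"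
proof -
  have "schur_poly N \<nu> (q_shift \<mu>) = jacobi_trudi N \<nu> (complete_fps N (q_shift \<mu>))"
    using vandermonde_q_shift_nonzero[OF assms(1)]
    by (simp add: schur_poly_eq_alternants[OF assms(3)] alternant_jacobi_trudi)
  also have "\<dots> = jacobi_trudi (plen \<nu>) \<nu> (complete_fps N (q_shift \<mu>))"
    using partition_eq_0_iff[OF assms(2)] assms(3) by (intro jacobi_trudi_stable) auto
  finally show ?thesis .
qed

text \<open>
  For \<open>N \<ge> plen \<nu>\<close> the Schur polynomial is a Jacobi-Trudi determinant of constant size in the complete
  symmetric polynomials, and these converge with the power sums. So the limit defining \<open>schur_eval\<close>
  exists.
\<close>

lemma schur_poly_tendsto:
  assumes "is_partition \<mu>" "is_partition \<nu>"
  shows "(\<lambda>N. schur_poly N \<nu> (q_shift \<mu>)) \<longlonglongrightarrow> schur_eval \<nu> \<mu>"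
proof -
  have "(\<lambda>N. jacobi_trudi (plen \<nu>) \<nu> (complete_fps N (q_shift \<mu>)))
      \<longlonglongrightarrow> jacobi_trudi (plen \<nu>) \<nu> (plexp (\<lambda>k. qhalf ^ k * shifted_sum \<mu> (q ^ k)))"
    unfolding complete_fps_eq_plexp
    by (intro jacobi_trudi_tendsto tendsto_plexp_nth power_sum_q_shift_tendsto assms)
  then have "(\<lambda>N. schur_poly N \<nu> (q_shift \<mu>))
      \<longlonglongrightarrow> jacobi_trudi (plen \<nu>) \<nu> (plexp (\<lambda>k. qhalf ^ k * shifted_sum \<mu> (q ^ k)))"
    by (rule Lim_transform_eventually)
      (use eventually_ge_at_top[of "plen \<nu>"] in
        \<open>eventually_elim, simp add: schur_poly_eq_jacobi_trudi assms\<close>)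
  then show ?thesis unfolding schur_eval_def by (simp add: limI)
qed

lemma schur_eval_symmetry:
  assumes "is_partition \<mu>" "is_partition \<nu>"
  shows "schur_eval \<mu> empty_part * schur_eval \<nu> \<mu> = schur_eval \<nu> empty_part * schur_eval \<mu> \<nu>"
proof (rule LIMSEQ_unique)
  show "(\<lambda>N. schur_poly N \<mu> (q_shift empty_part) * schur_poly N \<nu> (q_shift \<mu>))
      \<longlonglongrightarrow> schur_eval \<mu> empty_part * schur_eval \<nu> \<mu>"
    by (intro tendsto_mult schur_poly_tendsto assms is_partition_empty)
  have "(\<lambda>N. schur_poly N \<nu> (q_shift empty_part) * schur_poly N \<mu> (q_shift \<nu>))
      \<longlonglongrightarrow> schur_eval \<nu> empty_part * schur_eval \<mu> \<nu>"
    by (intro tendsto_mult schur_poly_tendsto assms is_partition_empty)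
  then show "(\<lambda>N. schur_poly N \<mu> (q_shift empty_part) * schur_poly N \<nu> (q_shift \<mu>))
      \<longlonglongrightarrow> schur_eval \<nu> empty_part * schur_eval \<mu> \<nu>"
    by (rule Lim_transform_eventually)
      (use eventually_ge_at_top[of "max (plen \<mu>) (plen \<nu>)"] in
        \<open>eventually_elim, simp add: schur_poly_symmetry assms\<close>)
qed

text \<open>
  Once \<open>N \<ge> n\<close> the bound \<open>plen \<nu> \<le> N\<close> holds for all partitions of \<open>n\<close>, and the identity in finitely
  many variables passes to the limit on both sides. On the right the kernel is an exponential in the
  products of power sums.
\<close>

lemma cauchy_identity_schur_eval:
  assumes "is_partition \<mu>1" "is_partition \<mu>2"
  shows "(\<Sum>\<nu> | is_partition \<nu> \<and> psize \<nu> = n. schur_eval \<nu> \<mu>1 * schur_eval \<nu> \<mu>2)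
       = plexp (\<lambda>k. q ^ k * (shifted_sum \<mu>1 (q ^ k) * shifted_sum \<mu>2 (q ^ k))) $ n"
proof (rule LIMSEQ_unique)
  let ?S = "\<lambda>N. \<Sum>\<nu> | is_partition \<nu> \<and> psize \<nu> = n. schur_poly N \<nu> (q_shift \<mu>1) * schur_poly N \<nu> (q_shift \<mu>2)"
  show "?S \<longlonglongrightarrow> (\<Sum>\<nu> | is_partition \<nu> \<and> psize \<nu> = n. schur_eval \<nu> \<mu>1 * schur_eval \<nu> \<mu>2)"
    by (intro tendsto_sum tendsto_mult schur_poly_tendsto assms) auto
  have finite: "?S N = plexp (\<lambda>k. (\<Sum>i<N. q_shift \<mu>1 i ^ k) * (\<Sum>j<N. q_shift \<mu>2 j ^ k)) $ n" if "n \<le> N" for N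
  proof -
    have "{\<nu>. is_partition \<nu> \<and> psize \<nu> = n} = {\<nu>. is_partition \<nu> \<and> plen \<nu> \<le> N \<and> psize \<nu> = n}"
      using plen_le_psize that by fastforce
    then have "?S N = (\<Prod>i<N. \<Prod>j<N. Abs_fps (\<lambda>k. (q_shift \<mu>1 i * q_shift \<mu>2 j) ^ k)) $ n"
      by (simp only: cauchy_identity[OF vandermonde_q_shift_nonzero vandermonde_q_shift_nonzero] assms)
    also have "(\<Prod>i<N. \<Prod>j<N. Abs_fps (\<lambda>k. (q_shift \<mu>1 i * q_shift \<mu>2 j) ^ k))
        = plexp (\<lambda>k. \<Sum>i<N. \<Sum>j<N. (q_shift \<mu>1 i * q_shift \<mu>2 j) ^ k)"
      by (simp only: plexp_sum plexp_power)
    finally show ?thesis by (simp only: sum_product power_mult_distrib)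
  qed
  have "(\<lambda>N. plexp (\<lambda>k. (\<Sum>i<N. q_shift \<mu>1 i ^ k) * (\<Sum>j<N. q_shift \<mu>2 j ^ k)) $ n)
      \<longlonglongrightarrow> plexp (\<lambda>k. (qhalf ^ k * shifted_sum \<mu>1 (q ^ k)) * (qhalf ^ k * shifted_sum \<mu>2 (q ^ k))) $ n"
    by (intro tendsto_plexp_nth tendsto_mult power_sum_q_shift_tendsto assms)
  also have "(\<lambda>k. (qhalf ^ k * shifted_sum \<mu>1 (q ^ k)) * (qhalf ^ k * shifted_sum \<mu>2 (q ^ k)))
      = (\<lambda>k. q ^ k * (shifted_sum \<mu>1 (q ^ k) * shifted_sum \<mu>2 (q ^ k)))"
    by (simp add: q_def power2_eq_square power_mult_distrib mult_ac)
  finally show "?S \<longlonglongrightarrow> plexp (\<lambda>k. q ^ k * (shifted_sum \<mu>1 (q ^ k) * shifted_sum \<mu>2 (q ^ k))) $ n"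
    by (rule Lim_transform_eventually)
      (use eventually_ge_at_top[of n] in \<open>eventually_elim, simp only: finite\<close>)
qed

section \<open>The principal specialization\<close>

lemma qbracket_eq_0_iff [simp]: "qbracket m = 0 \<longleftrightarrow> m = 0"
  by (auto simp: qbracket_def qhalf_powi_inj)

lemma q_powi_diff: "q powi a - q powi b = qhalf powi (a + b) * qbracket (a - b)"
  by (simp add: q_powi qbracket_def right_diff_distrib flip: power_int_add)

definition bracket_ratio :: "(nat \<Rightarrow> nat) \<Rightarrow> nat \<Rightarrow> nat \<Rightarrow> rat fls" where
  "bracket_ratio \<mu> i j = qbracket (int (\<mu> i) - int (\<mu> j) + int j - int i) / qbracket (int j - int i)"

text \<open>
  Each factor of the Vandermonde product is a bracket times a power of \<open>qhalf\<close> that is symmetric in the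
  two indices.
\<close>

lemma q_pairing_empty_ratio:
  "q_pairing N \<mu> (\<lambda>_. 0) / q_pairing N (\<lambda>_. 0) (\<lambda>_. 0)
     = (\<Prod>j<N. \<Prod>i<j. qhalf powi (- int (\<mu> i) - int (\<mu> j))) * (\<Prod>j<N. \<Prod>i<j. bracket_ratio \<mu> i j)"
proof -
  have "(q powi (int j - int (\<mu> j)) - q powi (int i - int (\<mu> i))) / (q powi (int j - int 0) - q powi (int i - int 0))
      = qhalf powi (- int (\<mu> i) - int (\<mu> j)) * bracket_ratio \<mu> i j" for i j
  proof -
    have exponent: "qhalf powi ((int j - int (\<mu> j)) + (int i - int (\<mu> i)))
        = qhalf powi (- int (\<mu> i) - int (\<mu> j)) * qhalf powi ((int j - int 0) + (int i - int 0))"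
      by (simp add: algebra_simps flip: power_int_add)
    have brackets: "int j - int (\<mu> j) - (int i - int (\<mu> i)) = int (\<mu> i) - int (\<mu> j) + int j - int i"
      "int j - int 0 - (int i - int 0) = int j - int i" by simp_all
    show ?thesis
      unfolding q_powi_diff bracket_ratio_def exponent brackets by (simp add: power_int_eq_0_iff)
  qed
  then show ?thesis
    unfolding q_pairing_empty prod_dividef[symmetric] prod.distrib[symmetric] by simp
qed

lemma sum_pairs:
  fixes g :: "nat \<Rightarrow> int"
  shows "(\<Sum>j<N. \<Sum>i<j. g i + g j) = (int N - 1) * (\<Sum>j<N. g j)"
proof (induction N)
  case (Suc N)
  then show ?case by (simp add: sum.distrib algebra_simps)
qed simp

lemma prod_shift_telescope:
  fixes g :: "int \<Rightarrow> 'a::comm_monoid_mult"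
  shows "(\<Prod>v=1..m. g (b + 1 + int v)) * g (b + 1) = (\<Prod>v=1..m. g (b + int v)) * g (b + 1 + int m)"
proof (induction m)
  case (Suc m)
  have "(\<Prod>v=1..Suc m. g (b + 1 + int v)) * g (b + 1)
      = ((\<Prod>v=1..m. g (b + 1 + int v)) * g (b + 1)) * g (b + 1 + int (Suc m))"
    by (simp add: mult_ac)
  also have "\<dots> = (\<Prod>v=1..m. g (b + int v)) * g (b + int (Suc m)) * g (b + 1 + int (Suc m))"
    unfolding Suc by (simp add: add_ac)
  finally show ?case by (simp add: mult_ac)
qed simp

text \<open>
  At \<open>N = plen \<mu>\<close> this is the denominator in \<open>W1 \<mu>\<close>; for larger \<open>N\<close> it collects the numerators that
  remain after telescoping.
\<close>

definition cell_product :: "(nat \<Rightarrow> nat) \<Rightarrow> nat \<Rightarrow> rat fls" where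
  "cell_product \<mu> N = (\<Prod>i<plen \<mu>. \<Prod>v=1..\<mu> i. qbracket (int N - int (i + 1) + int v))"

lemma cell_product_nonzero:
  assumes "plen \<mu> \<le> N"
  shows "cell_product \<mu> N \<noteq> 0"
  using assms by (auto simp: cell_product_def)

text \<open>
  Pairs of indices beyond the length contribute 1. For fixed \<open>i < plen \<mu>\<close> the factors with
  \<open>plen \<mu> \<le> j < N\<close> telescope, leaving \<open>\<mu> i\<close> brackets at each end, which are collected in
  \<open>cell_product\<close>.
\<close>

lemma prod_bracket_ratio:
  assumes "is_partition \<mu>" "plen \<mu> \<le> N"
  shows "(\<Prod>j<N. \<Prod>i<j. bracket_ratio \<mu> i j)
       = (\<Prod>j<plen \<mu>. \<Prod>i<j. bracket_ratio \<mu> i j) * (cell_product \<mu> N / cell_product \<mu> (plen \<mu>))"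
  using assms(2)
proof (induction N rule: dec_induct)
  case base
  then show ?case using cell_product_nonzero[of \<mu> "plen \<mu>"] by simp
next
  case (step N)
  have zero: "\<mu> i = 0" if "plen \<mu> \<le> i" for i using that partition_eq_0_iff[OF assms(1)] by simp
  have "(\<Prod>i<N. bracket_ratio \<mu> i N) = (\<Prod>i<plen \<mu>. bracket_ratio \<mu> i N)"
    using step(1) zero by (intro prod.mono_neutral_right) (auto simp: bracket_ratio_def)
  also have "\<dots> * cell_product \<mu> N = cell_product \<mu> (Suc N)"
    unfolding cell_product_def prod.distrib[symmetric]
  proof (rule prod.cong[OF refl])
    fix i assume i: "i \<in> {..<plen \<mu>}"
    let ?b = "int N - int (i + 1)"
    have "qbracket (?b + 1) \<noteq> 0" using i step(1) by auto
    then have telescope: "(\<Prod>v=1..\<mu> i. qbracket (?b + 1 + int v))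
        = (\<Prod>v=1..\<mu> i. qbracket (?b + int v)) * qbracket (?b + 1 + int (\<mu> i)) / qbracket (?b + 1)"
      using prod_shift_telescope[of qbracket ?b "\<mu> i"] by (rule eq_divide_imp)
    have arguments: "int (\<mu> i) - int (\<mu> N) + int N - int i = ?b + 1 + int (\<mu> i)" "int N - int i = ?b + 1"
      "\<And>v. int (Suc N) - int (i + 1) + int v = ?b + 1 + int v"
      using zero[OF step(1)] by simp_all
    show "bracket_ratio \<mu> i N * (\<Prod>v=1..\<mu> i. qbracket (?b + int v))
        = (\<Prod>v=1..\<mu> i. qbracket (int (Suc N) - int (i + 1) + int v))"
      unfolding bracket_ratio_def arguments telescope by (simp add: mult.commute)
  qed
  finally have "(\<Prod>i<N. bracket_ratio \<mu> i N) = cell_product \<mu> (Suc N) / cell_product \<mu> N"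
    using cell_product_nonzero[OF step(1)] by (simp add: field_simps)
  then show ?case using step(3) cell_product_nonzero[OF step(1)] by simp
qed

text \<open>
  The whole dependence on \<open>N\<close> is gathered in the last factor.
\<close>

lemma schur_poly_principal:
  assumes "is_partition \<mu>" "plen \<mu> \<le> N"
  shows "schur_poly N \<mu> (q_shift empty_part)
       = (\<Prod>j<plen \<mu>. \<Prod>i<j. bracket_ratio \<mu> i j) / cell_product \<mu> (plen \<mu>)
         * (qhalf powi (- int (N * psize \<mu>)) * cell_product \<mu> N)"
proof -
  have "(\<Prod>j<N. \<Prod>i<j. qhalf powi (- int (\<mu> i) - int (\<mu> j))) = qhalf powi ((int N - 1) * (- int (psize \<mu>)))"
    using sum_pairs[of "\<lambda>i. - int (\<mu> i)" N] psize_eq_sum[OF assms]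
    by (simp add: prod_powi sum_negf)
  then have "qhalf powi (- int (psize \<mu>)) * (\<Prod>j<N. \<Prod>i<j. qhalf powi (- int (\<mu> i) - int (\<mu> j)))
      = qhalf powi (- int (N * psize \<mu>))"
    by (simp add: algebra_simps flip: power_int_add)
  then show ?thesis
    using schur_poly_q_shift[OF is_partition_empty assms]
    by (simp add: q_pairing_sym[of N "\<lambda>_. 0" \<mu>] q_pairing_empty_ratio prod_bracket_ratio[OF assms] mult.assoc[symmetric]
        flip: times_divide_eq_right)
qed

lemma kappa_half:
  "kappa \<mu> div 2 = (\<Sum>i<plen \<mu>. \<Sum>v=1..\<mu> i. int v - int (i + 1))"
proof -
  have "2 * (\<Sum>v=1..m. int v - int (i + 1)) = int m * (int m - 2 * int (i + 1) + 1)" for m i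
    by (induction m) (auto simp: algebra_simps)
  then have "kappa \<mu> = 2 * (\<Sum>i<plen \<mu>. \<Sum>v=1..\<mu> i. int v - int (i + 1))"
    unfolding kappa_def sum_distrib_left by (intro sum.cong refl) (simp only:)
  then show ?thesis by simp
qed

text \<open>
  There is one factor for each of the \<open>psize \<mu>\<close> cells. Multiplied by \<open>qhalf powi (- N)\<close>, the bracket
  \<open>qbracket (N - (i + 1) + v)\<close> tends to \<open>qhalf powi (v - (i + 1))\<close>; these exponents are the contents of
  the cells and add up to \<open>kappa \<mu> div 2\<close>.
\<close>

lemma cell_product_tendsto:
  assumes "is_partition \<mu>"
  shows "(\<lambda>N. qhalf powi (- int (N * psize \<mu>)) * cell_product \<mu> N) \<longlonglongrightarrow> qhalf powi (kappa \<mu> div 2)"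
proof -
  have "qhalf powi (- int (N * psize \<mu>)) * cell_product \<mu> N
      = (\<Prod>i<plen \<mu>. \<Prod>v=1..\<mu> i. qhalf powi (- int N) * qbracket (int N - int (i + 1) + int v))" for N
  proof -
    have "(\<Prod>i<plen \<mu>. \<Prod>v=1..\<mu> i. qhalf powi (- int N)) = qhalf powi (- int (N * psize \<mu>))"
      by (simp add: prod_powi psize_def sum_distrib_left sum_negf mult.commute del: prod_constant)
    then show ?thesis by (simp only: cell_product_def prod.distrib)
  qed
  moreover have "(\<lambda>N. \<Prod>i<plen \<mu>. \<Prod>v=1..\<mu> i. qhalf powi (- int N) * qbracket (int N - int (i + 1) + int v))
      \<longlonglongrightarrow> (\<Prod>i<plen \<mu>. \<Prod>v=1..\<mu> i. qhalf powi (int v - int (i + 1)))"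
  proof (intro tendsto_prod')
    fix i v :: nat
    have "qhalf powi (- int N) * qbracket (int N - int (i + 1) + int v)
        = qhalf powi (int v - int (i + 1)) + (-1) * qhalf powi (int (i + 1) - int v - 2 * int N)" for N
      unfolding qbracket_def right_diff_distrib power_int_add[OF disjI1[OF qhalf_neq_0], symmetric]
      by (simp add: algebra_simps)
    moreover have "filterlim (\<lambda>N. int (i + 1) - int v - 2 * int N) at_bot sequentially"
      unfolding filterlim_at_bot eventually_sequentially
    proof
      fix Z :: int
      show "\<exists>M. \<forall>N\<ge>M. int (i + 1) - int v - 2 * int N \<le> Z"
        by (intro exI[of _ "nat (int (i + 1) - Z)"]) auto
    qed
    then have "(\<lambda>N. qhalf powi (int v - int (i + 1)) + (-1) * qhalf powi (int (i + 1) - int v - 2 * int N))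
        \<longlonglongrightarrow> qhalf powi (int v - int (i + 1)) + (-1) * 0"
      by (intro tendsto_add tendsto_mult tendsto_const qhalf_powi_tendsto_0)
    ultimately show "(\<lambda>N. qhalf powi (- int N) * qbracket (int N - int (i + 1) + int v))
        \<longlonglongrightarrow> qhalf powi (int v - int (i + 1))" by simp
  qed
  ultimately show ?thesis by (simp add: kappa_half prod_powi)
qed

text \<open>
  The explicit product is the principal specialization \<open>s_\<mu>(q^\<rho>)\<close>: the brackets at the near end of the
  telescoping products are the denominators, and those at the far end supply \<open>q\<close> to the power
  \<open>kappa \<mu> / 4\<close> in the limit.
\<close>

lemma W1_eq_schur_eval:
  assumes "is_partition \<mu>"
  shows "W1 \<mu> = schur_eval \<mu> empty_part"
proof (rule LIMSEQ_unique)
  let ?H = "(\<Prod>j<plen \<mu>. \<Prod>i<j. bracket_ratio \<mu> i j) / cell_product \<mu> (plen \<mu>)"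
  have "(\<lambda>N. ?H * (qhalf powi (- int (N * psize \<mu>)) * cell_product \<mu> N)) \<longlonglongrightarrow> ?H * qhalf powi (kappa \<mu> div 2)"
    by (intro tendsto_mult tendsto_const cell_product_tendsto assms)
  then have "(\<lambda>N. schur_poly N \<mu> (q_shift empty_part)) \<longlonglongrightarrow> ?H * qhalf powi (kappa \<mu> div 2)"
    by (rule Lim_transform_eventually)
      (use eventually_ge_at_top[of "plen \<mu>"] in
        \<open>eventually_elim, simp only: schur_poly_principal[OF assms]\<close>)
  moreover have "?H * qhalf powi (kappa \<mu> div 2) = W1 \<mu>"
  proof -
    have "(\<Prod>i<plen \<mu>. \<Prod>v=1..\<mu> i. 1 / qbracket (int v - int (i + 1) + int (plen \<mu>)))
        = 1 / cell_product \<mu> (plen \<mu>)"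
      by (simp add: cell_product_def prod_dividef algebra_simps)
    then show ?thesis unfolding W1_def bracket_ratio_def by (simp add: mult_ac)
  qed
  ultimately show "(\<lambda>N. schur_poly N \<mu> (q_shift empty_part)) \<longlonglongrightarrow> W1 \<mu>" by simp
  show "(\<lambda>N. schur_poly N \<mu> (q_shift empty_part)) \<longlonglongrightarrow> schur_eval \<mu> empty_part"
    by (intro schur_poly_tendsto assms is_partition_empty)
qed

lemma W2_symmetry:
  assumes "is_partition \<mu>" "is_partition \<nu>"
  shows "W2 \<mu> \<nu> = W2 \<nu> \<mu>"
  using schur_eval_symmetry[OF assms] by (simp add: W2_def W1_eq_schur_eval assms)

lemma plen_empty [simp]: "plen (\<lambda>_. 0) = 0"
  by (simp add: plen_def)

lemma W1_empty [simp]: "W1 (\<lambda>_. 0) = 1"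
  by (simp add: W1_def kappa_def)

text \<open>
  The symmetry of \<open>W2\<close> moves the summation index into the Schur functions, where the Cauchy identity
  applies.
\<close>

lemma K_eq_plexp:
  assumes "is_partition \<mu>1" "is_partition \<mu>2"
  shows "K \<mu>1 \<mu>2 = plexp (\<lambda>k. q ^ k * (shifted_sum \<mu>1 (q ^ k) * shifted_sum \<mu>2 (q ^ k)))
                   * fps_const (W1 \<mu>1) * fps_const (W1 \<mu>2)"
proof (rule fps_ext)
  fix n
  have "K \<mu>1 \<mu>2 $ n = (\<Sum>\<nu> | is_partition \<nu> \<and> psize \<nu> = n. W1 \<mu>1 * W1 \<mu>2 * (schur_eval \<nu> \<mu>1 * schur_eval \<nu> \<mu>2))"
    unfolding K_def fps_nth_Abs_fps
  proof (intro sum.cong refl)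
    fix \<nu> assume "\<nu> \<in> {\<nu>. is_partition \<nu> \<and> psize \<nu> = n}"
    then have "W2 \<nu> \<mu>2 = W2 \<mu>2 \<nu>" using W2_symmetry assms(2) by simp
    then show "W2 \<mu>1 \<nu> * W2 \<nu> \<mu>2 = W1 \<mu>1 * W1 \<mu>2 * (schur_eval \<nu> \<mu>1 * schur_eval \<nu> \<mu>2)"
      by (simp add: W2_def mult_ac)
  qed
  then show "K \<mu>1 \<mu>2 $ n = (plexp (\<lambda>k. q ^ k * (shifted_sum \<mu>1 (q ^ k) * shifted_sum \<mu>2 (q ^ k)))
                   * fps_const (W1 \<mu>1) * fps_const (W1 \<mu>2)) $ n"
    by (simp add: cauchy_identity_schur_eval[OF assms] mult_ac flip: sum_distrib_left)
qed

section \<open>The exponent as a Laurent polynomial\<close>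

lemma f_eq_shifted_sums:
  "f \<mu>1 \<mu>2 y = y * (shifted_sum \<mu>1 y * shifted_sum \<mu>2 y - shifted_sum (\<lambda>_. 0) y * shifted_sum (\<lambda>_. 0) y)"
  by (simp add: f_def shifted_sum_def)

lemma K_eq_exp:
  assumes "is_partition \<mu>1" "is_partition \<mu>2"
  shows "K \<mu>1 \<mu>2 = K empty_part empty_part * fps_const (W1 \<mu>1) * fps_const (W1 \<mu>2)
                   * plexp (\<lambda>n. f \<mu>1 \<mu>2 (q ^ n))"
proof -
  have "plexp (\<lambda>k. q ^ k * (shifted_sum \<mu>1 (q ^ k) * shifted_sum \<mu>2 (q ^ k)))
      = plexp (\<lambda>k. q ^ k * (shifted_sum (\<lambda>_. 0) (q ^ k) * shifted_sum (\<lambda>_. 0) (q ^ k)) + f \<mu>1 \<mu>2 (q ^ k))"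
    by (simp add: f_eq_shifted_sums algebra_simps)
  then show ?thesis
    unfolding K_eq_plexp[OF assms] K_eq_plexp[OF is_partition_empty is_partition_empty]
    by (simp add: plexp_add mult_ac)
qed

text \<open>
  Laurent polynomials with integer coefficients as functions, with the coefficients independent of the
  argument: the expansion of \<open>f\<close> is used at all positive powers of \<open>q\<close> at once.
\<close>

definition integral_laurent :: "('a::field \<Rightarrow> 'a) \<Rightarrow> bool" where
  "integral_laurent g \<longleftrightarrow> (\<exists>c::int \<Rightarrow> int. finite {k. c k \<noteq> 0} \<and>
     (\<forall>y. y \<noteq> 0 \<longrightarrow> g y = (\<Sum>k | c k \<noteq> 0. of_int (c k) * y powi k)))"

lemma integral_laurentI:
  assumes "finite S" "\<And>k. k \<notin> S \<Longrightarrow> c k = 0"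
    "\<And>y. y \<noteq> 0 \<Longrightarrow> g y = (\<Sum>k\<in>S. of_int (c k) * y powi k)"
  shows "integral_laurent g"
  unfolding integral_laurent_def
proof (intro exI[of _ c] conjI allI impI)
  have sub: "{k. c k \<noteq> 0} \<subseteq> S" using assms(2) by auto
  then show "finite {k. c k \<noteq> 0}" using assms(1) finite_subset by blast
  show "g y = (\<Sum>k | c k \<noteq> 0. of_int (c k) * y powi k)" if "y \<noteq> 0" for y
    unfolding assms(3)[OF that] using assms(1) sub by (intro sum.mono_neutral_right) auto
qed

lemma integral_laurentE:
  assumes "integral_laurent g"
  obtains S c where "finite S" "\<forall>k. k \<notin> S \<longrightarrow> c k = 0"
    "\<forall>y. y \<noteq> 0 \<longrightarrow> g y = (\<Sum>k\<in>S. of_int (c k) * y powi k)"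
proof -
  obtain c where "finite {k. c k \<noteq> 0}"
    "\<forall>y. y \<noteq> 0 \<longrightarrow> g y = (\<Sum>k | c k \<noteq> 0. of_int (c k) * y powi k)"
    using assms unfolding integral_laurent_def by blast
  then show thesis by (intro that[of "{k. c k \<noteq> 0}" c]) auto
qed

lemma integral_laurent_add:
  assumes "integral_laurent g" "integral_laurent h"
  shows "integral_laurent (\<lambda>y. g y + h y)"
proof -
  obtain S c where S: "finite S" "\<forall>k. k \<notin> S \<longrightarrow> c k = 0"
    "\<forall>y. y \<noteq> 0 \<longrightarrow> g y = (\<Sum>k\<in>S. of_int (c k) * y powi k)" using assms(1) by (rule integral_laurentE)
  obtain T d where T: "finite T" "\<forall>k. k \<notin> T \<longrightarrow> d k = 0"
    "\<forall>y. y \<noteq> 0 \<longrightarrow> h y = (\<Sum>k\<in>T. of_int (d k) * y powi k)" using assms(2) by (rule integral_laurentE)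
  show ?thesis
  proof (rule integral_laurentI[of "S \<union> T" "\<lambda>k. c k + d k"])
    fix y :: 'a assume "y \<noteq> 0"
    have "(\<Sum>k\<in>S. of_int (c k) * y powi k) = (\<Sum>k\<in>S \<union> T. of_int (c k) * y powi k)"
      using S T by (intro sum.mono_neutral_left) auto
    moreover have "(\<Sum>k\<in>T. of_int (d k) * y powi k) = (\<Sum>k\<in>S \<union> T. of_int (d k) * y powi k)"
      using S T by (intro sum.mono_neutral_left) auto
    ultimately show "g y + h y = (\<Sum>k\<in>S \<union> T. of_int (c k + d k) * y powi k)"
      using S(3) T(3) \<open>y \<noteq> 0\<close> by (simp add: sum.distrib distrib_right)
  qed (use S T in auto)
qed

lemma integral_laurent_zero: "integral_laurent (\<lambda>_. 0)"
  by (rule integral_laurentI[of "{}" "\<lambda>_. 0"]) auto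

lemma integral_laurent_sum:
  "(\<And>i. i \<in> I \<Longrightarrow> integral_laurent (g i)) \<Longrightarrow> integral_laurent (\<lambda>y. \<Sum>i\<in>I. g i y)"
  by (induction I rule: infinite_finite_induct) (simp_all add: integral_laurent_zero integral_laurent_add)

lemma integral_laurent_monom_mult:
  assumes "integral_laurent g"
  shows "integral_laurent (\<lambda>y. of_int a * y powi m * g y)"
proof -
  obtain S c where S: "finite S" "\<forall>k. k \<notin> S \<longrightarrow> c k = 0"
    "\<forall>y. y \<noteq> 0 \<longrightarrow> g y = (\<Sum>k\<in>S. of_int (c k) * y powi k)" using assms by (rule integral_laurentE)
  show ?thesis
  proof (rule integral_laurentI[of "(\<lambda>k. k + m) ` S" "\<lambda>k. a * c (k - m)"])
    fix k assume "k \<notin> (\<lambda>k. k + m) ` S"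
    then have "k - m \<notin> S" by (metis diff_add_cancel imageI)
    then show "a * c (k - m) = 0" using S(2) by simp
  next
    fix y :: 'a assume y: "y \<noteq> 0"
    show "of_int a * y powi m * g y = (\<Sum>k\<in>(\<lambda>k. k + m) ` S. of_int (a * c (k - m)) * y powi k)"
      using y by (simp add: S(3) sum.reindex sum_distrib_left power_int_add mult_ac)
  qed (use S in auto)
qed

lemma integral_laurent_powi: "integral_laurent (\<lambda>y. y powi m)"
  by (rule integral_laurentI[of "{m}" "\<lambda>k. if k = m then 1 else 0"]) auto

lemma integral_laurent_cong:
  assumes "integral_laurent g" "\<And>y. y \<noteq> 0 \<Longrightarrow> g y = h y"
  shows "integral_laurent h"
  using assms unfolding integral_laurent_def by metis

lemma integral_laurent_mult:
  assumes "integral_laurent g" "integral_laurent h"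
  shows "integral_laurent (\<lambda>y. g y * h y)"
proof -
  obtain S c where S: "finite S" "\<forall>k. k \<notin> S \<longrightarrow> c k = 0"
    "\<forall>y. y \<noteq> 0 \<longrightarrow> g y = (\<Sum>k\<in>S. of_int (c k) * y powi k)" using assms(1) by (rule integral_laurentE)
  show ?thesis
    by (rule integral_laurent_cong[of "\<lambda>y. \<Sum>k\<in>S. of_int (c k) * y powi k * h y"])
       (auto intro!: integral_laurent_sum integral_laurent_monom_mult assms(2) simp: S(3) sum_distrib_right)
qed

text \<open>
  The sum over the cells of the diagram of \<open>y\<close> to the content minus one; up to the factor \<open>y - 1\<close> this is
  the excess of the shifted sum (\<open>shifted_sum_excess_eq\<close>), by a geometric sum along each row.
\<close>

definition content_sum :: "(nat \<Rightarrow> nat) \<Rightarrow> 'a::field \<Rightarrow> 'a" where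
  "content_sum \<mu> y = (\<Sum>i<plen \<mu>. \<Sum>t<\<mu> i. y powi (int t - int (i + 1)))"

lemma integral_laurent_content_sum: "integral_laurent (content_sum \<mu>)"
  unfolding content_sum_def by (intro integral_laurent_sum integral_laurent_powi)

lemma shifted_sum_excess_eq:
  assumes "y \<noteq> 0"
  shows "shifted_sum_excess \<mu> y = (y - 1) * content_sum \<mu> y"
proof -
  have "y powi (int m - int (i + 1)) - y powi (- int (i + 1)) = (y - 1) * (\<Sum>t<m. y powi (int t - int (i + 1)))" for m i
  proof (induction m)
    case (Suc m)
    let ?P = "y powi (int m - int (i + 1))"
    have "y powi (int (Suc m) - int (i + 1)) = y * ?P"
      using assms power_int_add_1'[of y "int m - int (i + 1)"] by (simp add: algebra_simps)
    then have "y powi (int (Suc m) - int (i + 1)) - y powi (- int (i + 1))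
        = (y - 1) * ?P + (?P - y powi (- int (i + 1)))"
      by (simp only: left_diff_distrib) simp
    then show ?case unfolding Suc by (simp add: distrib_left)
  qed simp
  then show ?thesis unfolding shifted_sum_excess_def content_sum_def sum_distrib_left by (intro sum.cong refl)
qed

text \<open>
  With \<open>shifted_sum \<mu> y = (y - 1) * content_sum \<mu> y + 1 / (y - 1)\<close> the square of the polar part
  cancels in \<open>f\<close>, and the mixed terms lose their denominator.
\<close>

lemma f_eq_content_sums:
  assumes "is_partition \<mu>1" "is_partition \<mu>2" "n \<ge> 1" "y = q ^ n"
  shows "f \<mu>1 \<mu>2 y = y * (content_sum \<mu>1 y + content_sum \<mu>2 y
                          + (y - 1)^2 * content_sum \<mu>1 y * content_sum \<mu>2 y)"
proof -
  have y: "y \<noteq> 0" "y - 1 \<noteq> 0" using q_power_neq_1[OF assms(3)] by (auto simp: assms(4))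
  have sums: "shifted_sum \<mu> y = (y - 1) * content_sum \<mu> y + 1 / (y - 1)" if "is_partition \<mu>" for \<mu>
    using shifted_sum_eq[OF that assms(3)] shifted_sum_excess_eq[OF y(1)] by (simp add: assms(4))
  have empty: "content_sum (\<lambda>_. 0) y = 0" by (simp add: content_sum_def)
  have "(d * a + e) * (d * b + e) - (d * 0 + e) * (d * 0 + e) = (d * e) * (a + b) + d^2 * a * b"
    for a b d e :: "rat fls"
    by (simp add: algebra_simps power2_eq_square)
  note algebra = this[of "y - 1" _ "1 / (y - 1)"]
  show ?thesis
    unfolding f_eq_shifted_sums sums[OF assms(1)] sums[OF assms(2)] sums[OF is_partition_empty] empty algebra
    using y by simp
qed

text \<open>
  At \<open>y = q\<close> the monomials \<open>y powi k\<close> are distinct powers of \<open>fls_X\<close>, so the coefficients of the Laurent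
  polynomial can be read off there and are the numbers \<open>C \<mu>1 \<mu>2 k\<close>. The same coefficients then describe \<open>f\<close>
  at all positive powers of \<open>q\<close>.
\<close>

lemma f_laurent_expansion:
  assumes "is_partition \<mu>1" "is_partition \<mu>2"
    and "n \<ge> 1"
  shows "f \<mu>1 \<mu>2 (q ^ n) = (\<Sum>k | C \<mu>1 \<mu>2 k \<noteq> 0. of_int (C \<mu>1 \<mu>2 k) * (q powi k) ^ n)"
proof -
  let ?g = "\<lambda>y::rat fls. y * (content_sum \<mu>1 y + content_sum \<mu>2 y
                          + (y - 1)^2 * content_sum \<mu>1 y * content_sum \<mu>2 y)"
  have pow: "integral_laurent (\<lambda>y::rat fls. y ^ m)" for m
    using integral_laurent_powi[of "int m"] by (simp add: power_int_of_nat)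
  have const: "integral_laurent (\<lambda>y::rat fls. of_int a)" for a
    using integral_laurent_monom_mult[OF integral_laurent_powi[of 0], of a 0] by simp
  have "integral_laurent (\<lambda>y::rat fls. y ^ 1 * (content_sum \<mu>1 y + content_sum \<mu>2 y
      + ((y ^ 1 + of_int (-1)) * (y ^ 1 + of_int (-1))) * content_sum \<mu>1 y * content_sum \<mu>2 y))"
    by (intro integral_laurent_mult integral_laurent_add integral_laurent_content_sum pow const)
  then have "integral_laurent ?g" by (simp add: power2_eq_square)
  then obtain c where fin: "finite {k. c k \<noteq> 0}"
    and c: "\<And>y. y \<noteq> 0 \<Longrightarrow> ?g y = (\<Sum>k | c k \<noteq> 0. of_int (c k) * y powi k)"
    unfolding integral_laurent_def by blast
  have f_eq: "f \<mu>1 \<mu>2 (q ^ n) = (\<Sum>k | c k \<noteq> 0. of_int (c k) * (q ^ n) powi k)" if "n \<ge> 1" for n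
    unfolding f_eq_content_sums[OF assms(1,2) that refl] by (rule c) simp
  have "C \<mu>1 \<mu>2 k = c k" for k
  proof -
    have "fls_nth (of_int (c l) * q powi l) (- 2 * k) = (if l = k then of_int (c l) else 0)" for l
      by (simp add: fls_of_int q_powi fls_nth_qhalf_powi)
    moreover have "fls_nth (\<Sum>l\<in>S. g l) m = (\<Sum>l\<in>S. fls_nth (g l) m)" for g :: "int \<Rightarrow> rat fls" and S m
      by (induction S rule: infinite_finite_induct) auto
    ultimately have "fls_nth (f \<mu>1 \<mu>2 q) (- 2 * k) = (\<Sum>l | c l \<noteq> 0. if l = k then of_int (c l) else 0)"
      using f_eq[of 1] by simp
    then show ?thesis using fin by (simp add: C_def)
  qed
  then have C: "C \<mu>1 \<mu>2 = c" by auto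
  show "f \<mu>1 \<mu>2 (q ^ n) = (\<Sum>k | C \<mu>1 \<mu>2 k \<noteq> 0. of_int (C \<mu>1 \<mu>2 k) * (q powi k) ^ n)"
    unfolding C f_eq[OF assms(3)] by (simp add: power_int_power power_int_power' mult.commute)
qed

theorem theorem6p1:
  fixes \<mu>1 \<mu>2 :: "nat \<Rightarrow> nat"
  assumes "is_partition \<mu>1" and "is_partition \<mu>2"
  shows "K \<mu>1 \<mu>2 = K empty_part empty_part * fps_const (W1 \<mu>1) * fps_const (W1 \<mu>2)
           * fps_compose (fps_exp 1)
               (Abs_fps (\<lambda>n. if n = 0 then 0 else f \<mu>1 \<mu>2 (q ^ n) / of_nat n))
       \<and> K \<mu>1 \<mu>2 = K empty_part empty_part * fps_const (W1 \<mu>1) * fps_const (W1 \<mu>2)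
           * (\<Prod>k | C \<mu>1 \<mu>2 k \<noteq> 0. (1 - fps_const (q powi k) * fps_X) powi (- C \<mu>1 \<mu>2 k))"
proof -
  have "plexp (\<lambda>n. f \<mu>1 \<mu>2 (q ^ n))
      = plexp (\<lambda>n. \<Sum>k | C \<mu>1 \<mu>2 k \<noteq> 0. of_int (C \<mu>1 \<mu>2 k) * (q powi k) ^ n)"
    by (rule plexp_cong) (rule f_laurent_expansion[OF assms])
  also have "\<dots> = (\<Prod>k | C \<mu>1 \<mu>2 k \<noteq> 0. (1 - fps_const (q powi k) * fps_X) powi (- C \<mu>1 \<mu>2 k))"
    by (simp only: plexp_sum plexp_of_int_power)
  finally have "plexp (\<lambda>n. f \<mu>1 \<mu>2 (q ^ n))
      = (\<Prod>k | C \<mu>1 \<mu>2 k \<noteq> 0. (1 - fps_const (q powi k) * fps_X) powi (- C \<mu>1 \<mu>2 k))" .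
  then show ?thesis
    using K_eq_exp[OF assms] by (simp only: plexp_def[of "\<lambda>n. f \<mu>1 \<mu>2 (q ^ n)"] simp_thms)
qed

end
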